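(* Let $D_n(t,\lambda,y)$ be the polynomials defined by the J-type continued fraction in the context. For every $n\ge0$, $$D_n(t,\lambda,y)=\sum_{k=0}^{\lfloor n/2\rfloor}\gamma_{n,k}(\lambda,y)\,t^k(1+t)^{n-2k},$$ where the gamma coefficient $\gamma_{n,k}(\lambda,y)$ has the interpretations $$\gamma_{n,k}(\lambda,y)=\sum_{\sigma\in\mathfrak D_n^*(k)}\lambda^{\mathrm{pex}\,\sigma}y^{\mathrm{ear}\,\sigma}=\sum_{\sigma\in\mathfrak D_n^*(k)}\lambda^{\mathrm{cyc}\,\sigma}y^{\mathrm{ear}\,\sigma}=\sum_{\sigma\in\mathfrak D_n^*(k)}\lambda^{\mathrm{cyc}\,\sigma}y^{\mathrm{pex}\,\sigma}.$$
   Context: The polynomials $A_n(t,\lambda,y,w)$ ($n\ge0$) are defined by $$\sum_{n\ge0}A_n(t,\lambda,y,w)z^n=\cfrac{1}{1-\gamma_0z-\cfrac{\beta_1z^2}{1-\gamma_1z-\cfrac{\beta_2z^2}{\cdots}}},\qquad \gamma_n=w+n(t+1)\ (n\ge0),\quad \beta_n=t(\lambda+n-1)(y+n-1)\ (n\ge1),$$ and $D_n(t,\lambda,y)=A_n(t,\lambda,y,0)$. $\mathfrak S_n$ is the set of permutations of $[n]=\{1,\dots,n\}$, and $\mathfrak D_n\subseteq\mathfrak S_n$ the set of derangements (permutations without fixed points; $\mathfrak D_0$ consists of the empty permutation). For $\sigma\in\mathfrak S_n$: - $\mathrm{exc}\,\sigma$ is the number of $i$ with $\sigma(i)>i$; $\mathrm{cdrise}\,\sigma$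 is the number of cycle double rises, i.e. $i$ with $\sigma^{-1}(i)<i<\sigma(i)$. - $\mathfrak D_n^*(k)=\{\sigma\in\mathfrak D_n:\ \mathrm{exc}(\sigma)=k,\ \mathrm{cdrise}(\sigma)=0\}$ for $k\ge0$. - $\mathrm{pex}\,\sigma$ is the number of $i$ with $\sigma(i)>i$ and $\sigma(j)\notin[i,\sigma(i)]$ for all $j<i$. - $\mathrm{cyc}\,\sigma$ is the number of cycles. - An index $i$ is a record if $\sigma(j)<\sigma(i)$ for all $j<i$; an antirecord if $\sigma(j)>\sigma(i)$ for all $j>i$; an exclusive antirecord if it is an antirecord and not a record; a cycle peak if $\sigma^{-1}(i)<i>\sigma(i)$. $\mathrm{ear}\,\sigma$ is the number of $i$ that are both an exclusive antirecord and a cycle peak. *)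

theory Defs
  imports
    "HOL-Computational_Algebra.Formal_Power_Series"
    "HOL-Combinatorics.Permutations"
    "HOL-Combinatorics.Orbits"
begin

section \<open>J-fractions as formal power series\<close>

text \<open>
  The polynomials are represented by their values at elements of an arbitrary commutative ring.
  A polynomial ring over the integers is itself such a ring, so an identity that holds for all
  elements of all commutative rings is the same as an identity between polynomials.

  A coefficient ring has no division in general, but a power series with constant term 1 is
  invertible; its inverse is \<open>fps_right_inverse f 1\<close>.  The number \<open>N\<close> is the number of
  levels that are kept, and \<open>i\<close> is the level at which the fraction starts.
\<close>

fun J_convergent :: "(nat \<Rightarrow> 'a) \<Rightarrow> (nat \<Rightarrow> 'a) \<Rightarrow> nat \<Rightarrow> nat \<Rightarrow> 'a::comm_ring_1 fps" where
  "J_convergent \<gamma> \<beta> 0 i = 0"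
| "J_convergent \<gamma> \<beta> (Suc N) i =
     fps_right_inverse
       (1 - fps_const (\<gamma> i) * fps_X
          - fps_const (\<beta> (Suc i)) * fps_X ^ 2 * J_convergent \<gamma> \<beta> N (Suc i)) 1"

text \<open>The limit is taken in the usual topology of formal power series; it exists by the lemma
  \<open>J_convergent_tendsto\<close> below.\<close>

definition J_fraction :: "(nat \<Rightarrow> 'a) \<Rightarrow> (nat \<Rightarrow> 'a) \<Rightarrow> 'a::comm_ring_1 fps" where
  "J_fraction \<gamma> \<beta> = lim (\<lambda>N. J_convergent \<gamma> \<beta> N 0)"

lemma J_convergent_Suc_mult:
  "(1 - fps_const (\<gamma> i) * fps_X
      - fps_const (\<beta> (Suc i)) * fps_X ^ 2 * J_convergent \<gamma> \<beta> N (Suc i))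
    * J_convergent \<gamma> \<beta> (Suc N) i = 1"
  unfolding J_convergent.simps
  by (rule fps_right_inverse) (simp add: fps_mult_nth power2_eq_square)

lemma J_convergent_nth_stable:
  assumes "n < M" "M \<le> N"
  shows "fps_nth (J_convergent \<gamma> \<beta> N i) n = fps_nth (J_convergent \<gamma> \<beta> M i) n"
  using assms
proof (induction M arbitrary: N i n)
  case 0
  then show ?case by simp
next
  case (Suc M)
  then obtain N' where N': "N = Suc N'" "M \<le> N'"
    by (cases N) auto
  have "fps_right_inverse_constructor
          (1 - fps_const (\<gamma> i) * fps_X
             - fps_const (\<beta> (Suc i)) * fps_X ^ 2 * J_convergent \<gamma> \<beta> N' (Suc i)) 1 n =
        fps_right_inverse_constructor
          (1 - fps_const (\<gamma> i) * fps_X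
             - fps_const (\<beta> (Suc i)) * fps_X ^ 2 * J_convergent \<gamma> \<beta> M (Suc i)) 1 n"
  proof (rule fps_right_inverse_constructor_cong)
    fix m assume "m \<le> n"
    then have "m - 2 < M" if "m \<ge> 2"
      using that Suc.prems by linarith
    then have "fps_nth (J_convergent \<gamma> \<beta> N' (Suc i)) (m - 2) =
               fps_nth (J_convergent \<gamma> \<beta> M (Suc i)) (m - 2)" if "m \<ge> 2"
      using Suc.IH[of "m - 2" N'] N'(2) that by blast
    then show "fps_nth (1 - fps_const (\<gamma> i) * fps_X
             - fps_const (\<beta> (Suc i)) * fps_X ^ 2 * J_convergent \<gamma> \<beta> N' (Suc i)) m =
          fps_nth (1 - fps_const (\<gamma> i) * fps_X
             - fps_const (\<beta> (Suc i)) * fps_X ^ 2 * J_convergent \<gamma> \<beta> M (Suc i)) m"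
      by (simp add: mult.assoc fps_X_power_mult_nth)
  qed
  then show ?case
    using N'(1) by simp
qed

lemma J_convergent_tendsto: "(\<lambda>N. J_convergent \<gamma> \<beta> N 0) \<longlonglongrightarrow> J_fraction \<gamma> \<beta>"
proof -
  have "(\<lambda>N. J_convergent \<gamma> \<beta> N 0)
          \<longlonglongrightarrow> Abs_fps (\<lambda>n. fps_nth (J_convergent \<gamma> \<beta> (Suc n) 0) n)"
  proof (rule tendsto_fpsI)
    fix n
    show "\<forall>\<^sub>F N in sequentially. fps_nth (J_convergent \<gamma> \<beta> N 0) n =
            fps_nth (Abs_fps (\<lambda>n. fps_nth (J_convergent \<gamma> \<beta> (Suc n) 0) n)) n"
      unfolding eventually_sequentially fps_nth_Abs_fps
      using J_convergent_nth_stable[OF lessI] by blast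
  qed
  then show ?thesis
    unfolding J_fraction_def by (simp add: limI)
qed

definition A_poly :: "nat \<Rightarrow> 'a \<Rightarrow> 'a \<Rightarrow> 'a \<Rightarrow> 'a \<Rightarrow> 'a::comm_ring_1" where
  "A_poly n t lam y w =
     fps_nth (J_fraction (\<lambda>i. w + of_nat i * (t + 1))
                         (\<lambda>i. t * (lam + of_nat i - 1) * (y + of_nat i - 1))) n"

definition D_poly :: "nat \<Rightarrow> 'a \<Rightarrow> 'a \<Rightarrow> 'a \<Rightarrow> 'a::comm_ring_1" where
  "D_poly n t lam y = A_poly n t lam y 0"

section \<open>Permutation statistics\<close>

text \<open>A permutation of \<open>{1..n}\<close> is a function \<open>\<sigma>\<close> on the naturals with
  \<open>\<sigma> permutes {1..n}\<close>, hence the identity outside \<open>{1..n}\<close>.\<close>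

definition derangements :: "nat \<Rightarrow> (nat \<Rightarrow> nat) set" where
  "derangements n = {\<sigma>. \<sigma> permutes {1..n} \<and> (\<forall>i\<in>{1..n}. \<sigma> i \<noteq> i)}"

definition exc :: "nat \<Rightarrow> (nat \<Rightarrow> nat) \<Rightarrow> nat" where
  "exc n \<sigma> = card {i\<in>{1..n}. \<sigma> i > i}"

definition cdrise :: "nat \<Rightarrow> (nat \<Rightarrow> nat) \<Rightarrow> nat" where
  "cdrise n \<sigma> = card {i\<in>{1..n}. inv \<sigma> i < i \<and> i < \<sigma> i}"

definition derangements_star :: "nat \<Rightarrow> nat \<Rightarrow> (nat \<Rightarrow> nat) set" where
  "derangements_star n k = {\<sigma>\<in>derangements n. exc n \<sigma> = k \<and> cdrise n \<sigma> = 0}"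

definition pex :: "nat \<Rightarrow> (nat \<Rightarrow> nat) \<Rightarrow> nat" where
  "pex n \<sigma> = card {i\<in>{1..n}. \<sigma> i > i \<and> (\<forall>j\<in>{1..<i}. \<sigma> j \<notin> {i..\<sigma> i})}"

definition cyc :: "nat \<Rightarrow> (nat \<Rightarrow> nat) \<Rightarrow> nat" where
  "cyc n \<sigma> = card (orbit \<sigma> ` {1..n})"

definition is_record :: "nat \<Rightarrow> (nat \<Rightarrow> nat) \<Rightarrow> nat \<Rightarrow> bool" where
  "is_record n \<sigma> i \<longleftrightarrow> i \<in> {1..n} \<and> (\<forall>j\<in>{1..<i}. \<sigma> j < \<sigma> i)"

definition is_antirecord :: "nat \<Rightarrow> (nat \<Rightarrow> nat) \<Rightarrow> nat \<Rightarrow> bool" where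
  "is_antirecord n \<sigma> i \<longleftrightarrow> i \<in> {1..n} \<and> (\<forall>j\<in>{i<..n}. \<sigma> j > \<sigma> i)"

definition is_exclusive_antirecord :: "nat \<Rightarrow> (nat \<Rightarrow> nat) \<Rightarrow> nat \<Rightarrow> bool" where
  "is_exclusive_antirecord n \<sigma> i \<longleftrightarrow> is_antirecord n \<sigma> i \<and> \<not> is_record n \<sigma> i"

definition is_cycle_peak :: "nat \<Rightarrow> (nat \<Rightarrow> nat) \<Rightarrow> nat \<Rightarrow> bool" where
  "is_cycle_peak n \<sigma> i \<longleftrightarrow> i \<in> {1..n} \<and> inv \<sigma> i < i \<and> i > \<sigma> i"

definition ear :: "nat \<Rightarrow> (nat \<Rightarrow> nat) \<Rightarrow> nat" where
  "ear n \<sigma> = card {i\<in>{1..n}. is_exclusive_antirecord n \<sigma> i \<and> is_cycle_peak n \<sigma> i}"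

end

(*
  The coefficient of t^k (1 + t)^(n - 2k) in D_n is the weight of the Motzkin paths with n steps and
  k rises, in which a level step at height h has weight h and a rise to height h together with the
  matching fall has weight (lam + h - 1) (y + h - 1).  A derangement without cycle double rises is
  built by inserting 1, ..., n one after the other: valleys are rises, peaks are falls and cycle
  double falls are level steps, and the height is the number of open points.  There are two ways to
  organise the choices.  If the images of the open points are ordered as soon as a point is opened,
  then pex is governed by the position of a new valley, while ear, or alternatively cyc, is governed
  by the image of a new peak: the weight splits between rise and fall.  If preimage and image
  of a peak are both chosen when the peak is inserted, then cyc depends on the preimage for any
  fixed image and ear depends only on the image: both factors sit on the fall.
*)
theory Submission
  imports Defs
begin

text \<open>Putting the \<open>t\<close> of \<open>\<beta>\<close> on the rises and the
  \<open>1 + t\<close> of \<open>\<gamma>\<close> on the level steps gives a closed path with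
  \<open>k\<close> rises the factor t^k (1 + t)^(n - 2k). The remaining weight of a closed path
  depends on rise and fall weights only through their products (\<open>motzkin_rescale\<close>);
  this is why different distributions of the same two factors lead to the same coefficient. The need
  for two schemes comes from a conflict. If the order of the images is fixed on opening, the only
  choice left at a peak is its image \<open>m\<close>; it decides cyc and ear at once, and the two
  factors do not separate. Delaying the order to the closing supplies a second choice, but
  placeholders are then permuted by an insertion, and pex, which compares images of open points, can
  change at old points. Both schemes act on the same objects; the second uses only those with
  increasing placeholders. A statistic can be followed along the insertions only if it is settled at
  a point as soon as that point is inserted. Therefore cycles are counted at their maxima, and the
  antirecord condition is expressed by values already taken.\<close>

section \<open>Weighted Motzkin paths and J-fractions\<close>

text \<open>The total weight of the Motzkin paths from height \<open>0\<close> to height \<open>h\<close> with \<open>n\<close> steps, \<open>k\<close> of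
  which are rises.  A rise to height \<open>i\<close> has weight \<open>a i\<close>, a fall from height \<open>i\<close> has weight
  \<open>b i\<close>, and a level step at height \<open>i\<close> has weight \<open>i\<close>.\<close>

fun motzkin :: "(nat \<Rightarrow> 'a) \<Rightarrow> (nat \<Rightarrow> 'a) \<Rightarrow> nat \<Rightarrow> nat \<Rightarrow> nat \<Rightarrow> 'a::comm_ring_1" where
  "motzkin a b 0 h k = (if h = 0 \<and> k = 0 then 1 else 0)"
| "motzkin a b (Suc n) h k =
     (if h = 0 \<or> k = 0 then 0 else a h * motzkin a b n (h - 1) (k - 1)) +
     of_nat h * motzkin a b n h k + b (Suc h) * motzkin a b n (Suc h) k"

text \<open>In a path from 0 to \<open>h\<close> each fall from height \<open>i\<close> is matched
  with a rise to \<open>i\<close>. Only the last rises to \<open>1, ..., h\<close> stay unmatched,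
  and they account for the product, which is empty for closed paths.\<close>

lemma motzkin_rescale:
  "motzkin a b n h k = (\<Prod>i=1..h. a i) * motzkin (\<lambda>_. 1) (\<lambda>i. a i * b i) n h k"
proof (induction n arbitrary: h k)
  case 0
  then show ?case by simp
next
  case (Suc n)
  show ?case
  proof (cases "h = 0")
    case True
    then show ?thesis
      by (simp add: Suc.IH[of "Suc 0"] algebra_simps)
  next
    case False
    then obtain h' where h: "h = Suc h'"
      by (cases h) auto
    have "motzkin a b (Suc n) h k =
        (if k = 0 then 0 else a h * ((\<Prod>i=1..h'. a i) * motzkin (\<lambda>_. 1) (\<lambda>i. a i * b i) n h' (k - 1)))
        + of_nat h * ((\<Prod>i=1..h. a i) * motzkin (\<lambda>_. 1) (\<lambda>i. a i * b i) n h k)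
        + b (Suc h) * ((\<Prod>i=1..Suc h. a i) * motzkin (\<lambda>_. 1) (\<lambda>i. a i * b i) n (Suc h) k)"
      unfolding h motzkin.simps Suc.IH[symmetric] by simp
    then show ?thesis
      unfolding h by (simp add: algebra_simps)
  qed
qed

text \<open>With \<open>k\<close> rises and final height \<open>h\<close> there are
  \<open>k - h\<close> falls, hence at least \<open>2k - h\<close> steps.\<close>

lemma motzkin_eq_0: "n + h < 2 * k \<Longrightarrow> motzkin a b n h k = 0"
proof (induction n arbitrary: h k)
  case 0
  then show ?case by simp
next
  case (Suc n)
  then have "n + (h - 1) < 2 * (k - 1)" if "h \<noteq> 0"
    using that by linarith
  with Suc show ?case by simp
qed

section \<open>Tails of the J-fraction and generating functions of paths by final height\<close>

definition J_tail :: "(nat \<Rightarrow> 'a) \<Rightarrow> (nat \<Rightarrow> 'a) \<Rightarrow> nat \<Rightarrow> 'a::comm_ring_1 fps" where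
  "J_tail \<gamma> \<beta> i = Abs_fps (\<lambda>n. fps_nth (J_convergent \<gamma> \<beta> (Suc n) i) n)"

lemma J_tail_nth: "n < N \<Longrightarrow> fps_nth (J_tail \<gamma> \<beta> i) n = fps_nth (J_convergent \<gamma> \<beta> N i) n"
  using J_convergent_nth_stable[of n "Suc n" N \<gamma> \<beta> i] by (simp add: J_tail_def)

lemma J_fraction_eq_J_tail: "J_fraction \<gamma> \<beta> = J_tail \<gamma> \<beta> 0"
proof -
  have "(\<lambda>N. J_convergent \<gamma> \<beta> N 0) \<longlonglongrightarrow> J_tail \<gamma> \<beta> 0"
  proof (rule tendsto_fpsI)
    fix n
    show "\<forall>\<^sub>F N in sequentially. fps_nth (J_convergent \<gamma> \<beta> N 0) n = fps_nth (J_tail \<gamma> \<beta> 0) n"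
      unfolding eventually_sequentially
      by (metis J_tail_nth less_eq_Suc_le)
  qed
  then show ?thesis
    using J_convergent_tendsto LIMSEQ_unique by blast
qed

text \<open>The equation of the convergents passes to the limit: coefficient \<open>n\<close> of the
  product involves only coefficients up to \<open>n\<close>, where a tail agrees with a long enough
  convergent.\<close>

lemma J_tail_mult:
  "(1 - fps_const (\<gamma> i) * fps_X - fps_const (\<beta> (Suc i)) * fps_X ^ 2 * J_tail \<gamma> \<beta> (Suc i))
    * J_tail \<gamma> \<beta> i = 1"
proof (rule fps_ext)
  fix n
  let ?P = "\<lambda>F. 1 - fps_const (\<gamma> i) * fps_X - fps_const (\<beta> (Suc i)) * fps_X ^ 2 * F"
  have P: "fps_nth (?P (J_tail \<gamma> \<beta> (Suc i))) m = fps_nth (?P (J_convergent \<gamma> \<beta> (Suc n) (Suc i))) m"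
    if "m \<le> n" for m
    using that by (simp add: mult.assoc fps_X_power_mult_nth J_tail_nth[of "m - 2" "Suc n"] less_Suc_eq_le del: J_convergent.simps)
  \<comment> \<open>Level \<open>i\<close> keeps one more level than level \<open>Suc i\<close>, so
    that \<open>J_convergent_Suc_mult\<close> evaluates the right-hand side.\<close>
  have "fps_nth (?P (J_tail \<gamma> \<beta> (Suc i)) * J_tail \<gamma> \<beta> i) n =
      fps_nth (?P (J_convergent \<gamma> \<beta> (Suc n) (Suc i)) * J_convergent \<gamma> \<beta> (Suc (Suc n)) i) n"
    unfolding fps_mult_nth
  proof (rule sum.cong)
    fix m assume "m \<in> {0..n}"
    then show "fps_nth (?P (J_tail \<gamma> \<beta> (Suc i))) m * fps_nth (J_tail \<gamma> \<beta> i) (n - m) =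
      fps_nth (?P (J_convergent \<gamma> \<beta> (Suc n) (Suc i))) m *
      fps_nth (J_convergent \<gamma> \<beta> (Suc (Suc n)) i) (n - m)"
      using P[of m] J_tail_nth[of "n - m" "Suc (Suc n)" \<gamma> \<beta> i] by simp
  qed simp
  then show "fps_nth (?P (J_tail \<gamma> \<beta> (Suc i)) * J_tail \<gamma> \<beta> i) n = fps_nth 1 n"
    by (simp only: J_convergent_Suc_mult)
qed

text \<open>The generating function of the Motzkin paths that end at height \<open>h\<close>, by decomposition at the
  last visits to the heights \<open>0, \<dots>, h - 1\<close>.\<close>

definition J_column :: "(nat \<Rightarrow> 'a) \<Rightarrow> (nat \<Rightarrow> 'a) \<Rightarrow> nat \<Rightarrow> 'a::comm_ring_1 fps" where
  "J_column \<gamma> \<beta> h = fps_X ^ h * (\<Prod>i\<le>h. J_tail \<gamma> \<beta> i)"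

text \<open>The denominator \<open>p\<close> at level \<open>h\<close> cancels the last factor of
  the column, and its \<open>\<beta>\<close> term turns the column into the next one. The result is
  a recursion by the last step of a path, with rises of weight 1.\<close>

lemma J_column_rec:
  "J_column \<gamma> \<beta> h = (if h = 0 then 1 else fps_X * J_column \<gamma> \<beta> (h - 1)) +
     fps_const (\<gamma> h) * (fps_X * J_column \<gamma> \<beta> h) +
     fps_const (\<beta> (Suc h)) * (fps_X * J_column \<gamma> \<beta> (Suc h))"
proof -
  define p where "p = (1 - fps_const (\<gamma> h) * fps_X
     - fps_const (\<beta> (Suc h)) * fps_X ^ 2 * J_tail \<gamma> \<beta> (Suc h))"
  have 1: "p * J_tail \<gamma> \<beta> h = 1"
    unfolding p_def by (rule J_tail_mult)
  have "p * J_column \<gamma> \<beta> h = (if h = 0 then 1 else fps_X * J_column \<gamma> \<beta> (h - 1))"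
  proof (cases h)
    case 0
    then show ?thesis using 1 by (simp add: J_column_def)
  next
    case (Suc h')
    have "p * J_column \<gamma> \<beta> h = (p * J_tail \<gamma> \<beta> h) * (fps_X * J_column \<gamma> \<beta> h')"
      unfolding J_column_def Suc by (simp add: algebra_simps)
    then show ?thesis
      using Suc 1 by simp
  qed
  moreover have "p * J_column \<gamma> \<beta> h = J_column \<gamma> \<beta> h - fps_const (\<gamma> h) * (fps_X * J_column \<gamma> \<beta> h) -
     fps_const (\<beta> (Suc h)) * (fps_X * J_column \<gamma> \<beta> (Suc h))"
    unfolding p_def J_column_def by (simp add: algebra_simps power2_eq_square)
  ultimately show ?thesis
    by (simp add: algebra_simps)
qed

lemma J_column_nth_0: "fps_nth (J_column \<gamma> \<beta> h) 0 = (if h = 0 then 1 else 0)"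
  by (subst J_column_rec) simp

lemma J_column_nth_Suc:
  "fps_nth (J_column \<gamma> \<beta> h) (Suc n) = (if h = 0 then 0 else fps_nth (J_column \<gamma> \<beta> (h - 1)) n) +
     \<gamma> h * fps_nth (J_column \<gamma> \<beta> h) n + \<beta> (Suc h) * fps_nth (J_column \<gamma> \<beta> (Suc h)) n"
  by (subst J_column_rec) simp

text \<open>A path from 0 to \<open>h\<close> with \<open>k\<close> rises has
  \<open>n + h - 2k\<close> level steps, each contributing \<open>1 + t\<close>.
  \<open>J_column\<close> carries the factor \<open>t\<close> on the falls, the right-hand side on
  the rises; the \<open>h\<close> unmatched rises are compensated by \<open>t ^ h\<close>.\<close>

lemma J_column_nth_eq_sum_motzkin:
  fixes t :: "'a::comm_ring_1"
  assumes "\<And>i. \<gamma> i = of_nat i * (1 + t)" "\<And>i. \<beta> (Suc i) = t * b (Suc i)"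
  shows "t ^ h * fps_nth (J_column \<gamma> \<beta> h) n =
    (\<Sum>k\<le>(n + h) div 2. motzkin (\<lambda>_. 1) b n h k * t ^ k * (1 + t) ^ (n + h - 2 * k))"
proof (induction n arbitrary: h)
  case 0
  have "(\<Sum>k\<le>(0 + h) div 2. motzkin (\<lambda>_. 1) b 0 h k * t ^ k * (1 + t) ^ (0 + h - 2 * k)) =
     (\<Sum>k\<le>(0 + h) div 2. if k = 0 then (if h = 0 then 1 else 0) else 0)"
    by (rule sum.cong) auto
  then show ?case
    by (simp add: J_column_nth_0)
next
  case (Suc n)
  define T where "T = (\<lambda>n h k. motzkin (\<lambda>_. 1) b n h k * t ^ k * (1 + t) ^ (n + h - 2 * k))"
  have IH: "t ^ h * fps_nth (J_column \<gamma> \<beta> h) n = (\<Sum>k\<le>(n + h) div 2. T n h k)" for h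
    unfolding T_def by (rule Suc.IH)
  define N where "N = (Suc n + h) div 2"
  define up where "up = (\<lambda>k. if h = 0 \<or> k = 0 then 0 else t * T n (h - 1) (k - 1))"
  have T_Suc: "T (Suc n) h k = up k + of_nat h * (1 + t) * T n h k + b (Suc h) * T n (Suc h) k"
    if "k \<le> N" for k
  proof -
    have e1: "n + (h - 1) - 2 * (k - 1) = Suc n + h - 2 * k" "t ^ k = t * t ^ (k - 1)"
      if "h \<noteq> 0" "k \<noteq> 0" using that by (auto simp: power_eq_if)
    have e2: "(1 + t) ^ (Suc n + h - 2 * k) = (1 + t) * (1 + t) ^ (n + h - 2 * k)"
      if "2 * k \<le> n + h" using that by (simp add: Suc_diff_le)
    \<comment> \<open>For \<open>2k > n + h\<close> truncated subtraction spoils \<open>e2\<close>,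
      but then no such path exists.\<close>
    have "motzkin (\<lambda>_. 1) b n h k = 0" if "\<not> 2 * k \<le> n + h"
      using that by (intro motzkin_eq_0) auto
    then have e3: "motzkin (\<lambda>_. 1) b n h k * (1 + t) ^ (Suc n + h - 2 * k) =
        motzkin (\<lambda>_. 1) b n h k * ((1 + t) * (1 + t) ^ (n + h - 2 * k))"
      using e2 by (cases "2 * k \<le> n + h") auto
    have "T (Suc n) h k = (if h = 0 \<or> k = 0 then 0 else motzkin (\<lambda>_. 1) b n (h - 1) (k - 1)) * t ^ k *
          (1 + t) ^ (Suc n + h - 2 * k) +
        of_nat h * t ^ k * (motzkin (\<lambda>_. 1) b n h k * (1 + t) ^ (Suc n + h - 2 * k)) +
        b (Suc h) * motzkin (\<lambda>_. 1) b n (Suc h) k * t ^ k * (1 + t) ^ (Suc n + h - 2 * k)"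
      unfolding T_def by (simp add: algebra_simps)
    also have "\<dots> = up k + of_nat h * (1 + t) * T n h k + b (Suc h) * T n (Suc h) k"
      unfolding e3 up_def T_def using e1 by (simp add: algebra_simps)
    finally show ?thesis .
  qed
  have "(\<Sum>k\<le>N. up k) = (if h = 0 then 0 else t ^ h * fps_nth (J_column \<gamma> \<beta> (h - 1)) n)"
  proof (cases h)
    case (Suc h')
    then have "N = Suc ((n + h') div 2)"
      by (simp add: N_def)
    then have "(\<Sum>k\<le>N. up k) = t * (\<Sum>k\<le>(n + h') div 2. T n h' k)"
      by (simp add: sum.atMost_Suc_shift up_def Suc sum_distrib_left del: sum.atMost_Suc)
    then show ?thesis
      using Suc by (simp add: IH[symmetric] mult.assoc)
  qed (simp add: up_def)
  moreover have "(\<Sum>k\<le>N. T n h k) = t ^ h * fps_nth (J_column \<gamma> \<beta> h) n"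
    unfolding IH
  proof (rule sum.mono_neutral_right)
    show "\<forall>k\<in>{..N} - {..(n + h) div 2}. T n h k = 0"
      unfolding T_def by (intro ballI) (subst motzkin_eq_0, auto)
  qed (auto simp: N_def)
  moreover have "(\<Sum>k\<le>N. T n (Suc h) k) = t ^ Suc h * fps_nth (J_column \<gamma> \<beta> (Suc h)) n"
    unfolding IH N_def by simp
  ultimately have "(\<Sum>k\<le>N. T (Suc n) h k) = t ^ h * fps_nth (J_column \<gamma> \<beta> h) (Suc n)"
    by (simp add: T_Suc sum.distrib sum_distrib_left[symmetric] J_column_nth_Suc
        assms algebra_simps)
  then show ?case
    unfolding T_def N_def by simp
qed

lemma D_poly_eq_sum_motzkin:
  "D_poly n t lam y = (\<Sum>k=0..n div 2.
     motzkin (\<lambda>_. 1) (\<lambda>i. (lam + of_nat i - 1) * (y + of_nat i - 1)) n 0 k * t ^ k * (1 + t) ^ (n - 2 * k))"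
proof -
  define \<gamma> where "\<gamma> = (\<lambda>i. 0 + of_nat i * (t + 1))"
  define \<beta> where "\<beta> = (\<lambda>i. t * (lam + of_nat i - 1) * (y + of_nat i - 1))"
  have "D_poly n t lam y = fps_nth (J_fraction \<gamma> \<beta>) n"
    by (simp add: D_poly_def A_poly_def \<gamma>_def \<beta>_def)
  moreover have "J_fraction \<gamma> \<beta> = J_column \<gamma> \<beta> 0"
    by (simp add: J_fraction_eq_J_tail J_column_def)
  moreover have "t ^ 0 * fps_nth (J_column \<gamma> \<beta> 0) n = (\<Sum>k\<le>(n + 0) div 2.
      motzkin (\<lambda>_. 1) (\<lambda>i. (lam + of_nat i - 1) * (y + of_nat i - 1)) n 0 k * t ^ k * (1 + t) ^ (n + 0 - 2 * k))"
    by (rule J_column_nth_eq_sum_motzkin) (simp_all add: \<gamma>_def \<beta>_def algebra_simps)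
  ultimately show ?thesis
    by (simp add: atMost_atLeast0)
qed

section \<open>Partial permutations\<close>

text \<open>The trace that a derangement \<open>\<sigma>\<close> without cycle double rises leaves on \<open>{1..n}\<close>: a point whose
  image exceeds \<open>n\<close> is open, and the images of the \<open>h\<close> open points are replaced, in the same order,
  by the placeholders \<open>n + 1, \<dots>, n + h\<close>.  Placeholders are fixed by \<open>\<tau>\<close>, so that iterating \<open>\<tau>\<close>
  from a point of an open path stops at a placeholder.  The last conjunct says that \<open>\<tau>\<close> has no
  fixed points and that an excedance is never the image of a smaller point.\<close>

definition partial_perm :: "nat \<Rightarrow> nat \<Rightarrow> (nat \<Rightarrow> nat) \<Rightarrow> bool" where
  "partial_perm n h \<tau> \<longleftrightarrow> inj_on \<tau> {1..n} \<and> \<tau> ` {1..n} \<subseteq> {1..n + h} \<and> {Suc n..n + h} \<subseteq> \<tau> ` {1..n} \<and>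
     (\<forall>i. i \<notin> {1..n} \<longrightarrow> \<tau> i = i) \<and>
     (\<forall>i\<in>{1..n}. \<tau> i \<noteq> i \<and> (\<tau> i > i \<longrightarrow> i \<notin> \<tau> ` {1..<i}))"

text \<open>These points have no preimage yet: they are the starts of the open paths and the
  possible images of the next cycle double fall or peak.\<close>

definition missing :: "nat \<Rightarrow> (nat \<Rightarrow> nat) \<Rightarrow> nat set" where
  "missing n \<tau> = {1..n} - \<tau> ` {1..n}"

definition ins :: "nat \<Rightarrow> (nat \<Rightarrow> nat) \<Rightarrow> nat \<Rightarrow> (nat \<Rightarrow> nat) \<Rightarrow> nat \<Rightarrow> nat" where
  "ins n \<phi> x \<tau> i = (if i = Suc n then x else if i \<in> {1..n} then \<phi> (\<tau> i) else i)"

definition del :: "nat \<Rightarrow> (nat \<Rightarrow> nat) \<Rightarrow> (nat \<Rightarrow> nat) \<Rightarrow> nat \<Rightarrow> nat" where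
  "del n \<psi> \<tau> i = (if i \<in> {1..n} then \<psi> (\<tau> i) else i)"

lemma finite_partial_perms: "finite {\<tau>. partial_perm n h \<tau>}"
proof (rule finite_imageD)
  show "finite ((\<lambda>\<tau>. restrict \<tau> {1..n}) ` {\<tau>. partial_perm n h \<tau>})"
  proof (rule finite_subset)
    show "(\<lambda>\<tau>. restrict \<tau> {1..n}) ` {\<tau>. partial_perm n h \<tau>} \<subseteq> {1..n} \<rightarrow>\<^sub>E {1..n + h}"
    proof (rule image_subsetI)
      fix \<tau> assume "\<tau> \<in> {\<tau>. partial_perm n h \<tau>}"
      then have "\<tau> ` {1..n} \<subseteq> {1..n + h}"
        by (simp add: partial_perm_def)
      then show "restrict \<tau> {1..n} \<in> {1..n} \<rightarrow>\<^sub>E {1..n + h}"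
        by (intro restrict_PiE_iff[THEN iffD2] ballI) blast
    qed
  qed (simp add: finite_PiE)
  show "inj_on (\<lambda>\<tau>. restrict \<tau> {1..n}) {\<tau>. partial_perm n h \<tau>}"
  proof (rule inj_onI, rule ext)
    fix \<tau> \<tau>' i
    assume *: "\<tau> \<in> {\<tau>. partial_perm n h \<tau>}" "\<tau>' \<in> {\<tau>. partial_perm n h \<tau>}"
      and **: "restrict \<tau> {1..n} = restrict \<tau>' {1..n}"
    show "\<tau> i = \<tau>' i"
    proof (cases "i \<in> {1..n}")
      case True
      then show ?thesis using fun_cong[OF **, of i] by simp
    next
      case False
      then show ?thesis using * by (simp add: partial_perm_def)
    qed
  qed
qed

text \<open>Of the \<open>n + h\<close> admissible values \<open>n\<close> are taken, among them all
  \<open>h\<close> placeholders. This count gives the weight of a level step.\<close>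

lemma card_missing:
  assumes "partial_perm n h \<tau>"
  shows "card (missing n \<tau>) = h"
proof -
  have s: "inj_on \<tau> {1..n}" "\<tau> ` {1..n} \<subseteq> {1..n + h}" "{Suc n..n + h} \<subseteq> \<tau> ` {1..n}"
    using assms by (auto simp: partial_perm_def)
  have "card (\<tau> ` {1..n}) = n"
    using s(1) by (simp add: card_image)
  moreover have "missing n \<tau> = {1..n + h} - \<tau> ` {1..n}"
  proof -
    have "{1..n + h} = {1..n} \<union> {Suc n..n + h}"
      by auto
    then show ?thesis
      unfolding missing_def using s(3) by blast
  qed
  ultimately show ?thesis
    using s(2) by (simp add: card_Diff_subset)
qed

lemma partial_perm_0: "{\<tau>. partial_perm 0 h \<tau>} = (if h = 0 then {id} else {})"
  by (auto simp: partial_perm_def)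

lemma del_ins:
  assumes "partial_perm n h \<tau>" "\<And>v. v \<in> \<tau> ` {1..n} \<Longrightarrow> \<psi> (\<phi> v) = v"
  shows "del n \<psi> (ins n \<phi> x \<tau>) = \<tau>"
  using assms by (auto simp: fun_eq_iff del_def ins_def partial_perm_def)

lemma ins_del:
  assumes "partial_perm (Suc n) h \<tau>" "\<And>v. v \<in> \<tau> ` {1..n} \<Longrightarrow> \<phi> (\<psi> v) = v"
  shows "ins n \<phi> (\<tau> (Suc n)) (del n \<psi> \<tau>) = \<tau>"
  using assms by (auto simp: fun_eq_iff del_def ins_def partial_perm_def)

lemma ins_image: "ins n \<phi> x \<tau> ` {1..Suc n} = insert x (\<phi> ` \<tau> ` {1..n})"
proof -
  have "ins n \<phi> x \<tau> ` {1..n} = \<phi> ` \<tau> ` {1..n}"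
    unfolding image_image by (rule image_cong) (auto simp: ins_def)
  moreover have "{1..Suc n} = insert (Suc n) {1..n}" "ins n \<phi> x \<tau> (Suc n) = x"
    by (auto simp: ins_def)
  ultimately show ?thesis
    by (simp only: image_insert)
qed

lemma ins_image_less: "i \<le> Suc n \<Longrightarrow> ins n \<phi> x \<tau> ` {1..<i} = \<phi> ` \<tau> ` {1..<i}"
  unfolding image_image by (rule image_cong) (auto simp: ins_def)

text \<open>Since \<open>\<phi>\<close> fixes proper values and keeps placeholders above
  \<open>n\<close>, every comparison with an old point persists. The other hypotheses concern the
  new point and the new range of placeholders; \<open>cd\<close> excludes a cycle double rise at
  \<open>n + 1\<close>.\<close>

lemma partial_perm_ins:
  assumes st: "partial_perm n h \<tau>"
    and \<phi>: "\<And>v. v \<le> n \<Longrightarrow> \<phi> v = v" "\<And>v. v > n \<Longrightarrow> \<phi> v > n" "inj_on \<phi> {1..n + h}"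
    and x: "x \<noteq> Suc n" "x \<notin> \<phi> ` \<tau> ` {1..n}" "x \<in> {1..Suc n + h'}"
    and cov: "\<phi> ` {Suc n..n + h} \<subseteq> {1..Suc n + h'}"
      "{Suc (Suc n)..Suc n + h'} \<subseteq> insert x (\<phi> ` {Suc n..n + h})"
    and cd: "x > Suc n \<Longrightarrow> Suc n \<notin> \<phi> ` {Suc n..n + h}"
  shows "partial_perm (Suc n) h' (ins n \<phi> x \<tau>)"
proof -
  have s: "inj_on \<tau> {1..n}" "\<tau> ` {1..n} \<subseteq> {1..n + h}" "{Suc n..n + h} \<subseteq> \<tau> ` {1..n}"
    and nf: "\<And>i. i \<in> {1..n} \<Longrightarrow> \<tau> i \<noteq> i"
    and nc: "\<And>i. i \<in> {1..n} \<Longrightarrow> \<tau> i > i \<Longrightarrow> i \<notin> \<tau> ` {1..<i}"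
    using st by (auto simp: partial_perm_def)
  have gt: "\<phi> v > i \<longleftrightarrow> v > i" "\<phi> v = i \<longleftrightarrow> v = i" if "i \<le> n" for v i
    using \<phi>(1,2)[of v] that by (cases "v \<le> n"; simp)+
  have "inj_on (ins n \<phi> x \<tau>) {1..Suc n}"
  proof -
    have "inj_on (\<phi> \<circ> \<tau>) {1..n}"
      using s(1,2) \<phi>(3) by (meson comp_inj_on inj_on_subset)
    then have "inj_on (ins n \<phi> x \<tau>) {1..n}"
      by (rule inj_on_cong[THEN iffD1, rotated]) (auto simp: ins_def)
    moreover have "ins n \<phi> x \<tau> ` {1..n} = \<phi> ` \<tau> ` {1..n}"
      using ins_image_less[of "Suc n" n] by (simp add: atLeastLessThanSuc_atLeastAtMost)
    moreover have "{1..Suc n} = insert (Suc n) {1..n}" "ins n \<phi> x \<tau> (Suc n) = x"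
      by (auto simp: ins_def)
    ultimately show ?thesis
      using x(2) by simp
  qed
  moreover have "ins n \<phi> x \<tau> ` {1..Suc n} \<subseteq> {1..Suc n + h'}"
  proof -
    have "\<phi> v \<in> {1..Suc n + h'}" if "v \<in> {1..n + h}" for v
    proof (cases "v \<le> n")
      case True
      then show ?thesis using \<phi>(1)[of v] that by auto
    next
      case False
      then show ?thesis using cov(1) that by (intro subsetD[OF cov(1)]) auto
    qed
    then show ?thesis
      unfolding ins_image using x(3) s(2) by blast
  qed
  moreover have "{Suc (Suc n)..Suc n + h'} \<subseteq> ins n \<phi> x \<tau> ` {1..Suc n}"
    unfolding ins_image using cov(2) s(3) by blast
  moreover have "\<forall>i. i \<notin> {1..Suc n} \<longrightarrow> ins n \<phi> x \<tau> i = i"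
    by (auto simp: ins_def)
  moreover have "ins n \<phi> x \<tau> i \<noteq> i \<and> (ins n \<phi> x \<tau> i > i \<longrightarrow> i \<notin> ins n \<phi> x \<tau> ` {1..<i})"
    if i: "i \<in> {1..Suc n}" for i
  proof (cases "i = Suc n")
    case True
    have "v > n" if "v \<in> {1..n + h}" "\<phi> v = Suc n" for v
      using that \<phi>(1)[of v] by (cases "v \<le> n") auto
    then have "v \<in> {Suc n..n + h}" if "v \<in> \<tau> ` {1..n}" "\<phi> v = Suc n" for v
      using that subsetD[OF s(2) that(1)] by fastforce
    then have "Suc n \<in> \<phi> ` {Suc n..n + h}" if "Suc n \<in> \<phi> ` \<tau> ` {1..n}"
      using that by force
    then have "Suc n \<notin> \<phi> ` \<tau> ` {1..n}" if "x > Suc n"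
      using cd[OF that] by blast
    moreover have "ins n \<phi> x \<tau> ` {1..<Suc n} = \<phi> ` \<tau> ` {1..n}"
      using ins_image_less[of "Suc n" n] by (simp add: atLeastLessThanSuc_atLeastAtMost)
    ultimately show ?thesis
      using x(1) unfolding True by (simp add: ins_def)
  next
    case False
    then have i: "i \<in> {1..n}" and v: "ins n \<phi> x \<tau> i = \<phi> (\<tau> i)"
      using i by (auto simp: ins_def)
    have "i \<in> ins n \<phi> x \<tau> ` {1..<i} \<longleftrightarrow> i \<in> \<tau> ` {1..<i}"
    proof -
      have "\<phi> u = i \<longleftrightarrow> u = i" for u
        using gt(2)[of i] i by simp
      moreover have "ins n \<phi> x \<tau> ` {1..<i} = \<phi> ` \<tau> ` {1..<i}"
        using i by (intro ins_image_less) simp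
      ultimately show ?thesis
        by (metis (no_types, lifting) imageE imageI)
    qed
    then show ?thesis
      using nf[OF i] nc[OF i] gt[of i "\<tau> i"] i v by simp
  qed
  ultimately show ?thesis
    unfolding partial_perm_def by blast
qed

text \<open>Injectivity of \<open>\<psi>\<close> is asked only on the values of old points, because
  \<open>up_unshift\<close> is injective only away from the two numbers that \<open>up_shift\<close>
  leaves out.\<close>

lemma partial_perm_del:
  assumes st: "partial_perm (Suc n) h' \<tau>"
    and \<psi>: "\<And>v. v \<le> n \<Longrightarrow> \<psi> v = v" "\<And>v. v \<in> \<tau> ` {1..n} \<Longrightarrow> v > n \<Longrightarrow> \<psi> v > n" "inj_on \<psi> (\<tau> ` {1..n})"
    and ran: "\<psi> ` \<tau> ` {1..n} \<subseteq> {1..n + h}" "{Suc n..n + h} \<subseteq> \<psi> ` \<tau> ` {1..n}"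
  shows "partial_perm n h (del n \<psi> \<tau>)" and "i \<le> n \<Longrightarrow> i \<in> del n \<psi> \<tau> ` {1..n} \<longleftrightarrow> i \<in> \<tau> ` {1..n}"
proof -
  have s: "inj_on \<tau> {1..n}"
    and nf: "\<And>i. i \<in> {1..n} \<Longrightarrow> \<tau> i \<noteq> i"
    and nc: "\<And>i. i \<in> {1..n} \<Longrightarrow> \<tau> i > i \<Longrightarrow> i \<notin> \<tau> ` {1..<i}"
    using st by (auto simp: partial_perm_def intro: inj_on_subset)
  have gt: "\<psi> v > i \<longleftrightarrow> v > i" "\<psi> v = i \<longleftrightarrow> v = i" if "i \<le> n" "v \<in> \<tau> ` {1..n}" for v i
    using \<psi>(1,2)[of v] that by (cases "v \<le> n"; simp)+
  have im: "del n \<psi> \<tau> ` {1..<i} = \<psi> ` \<tau> ` {1..<i}" if "i \<le> Suc n" for i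
    unfolding image_image using that by (intro image_cong) (auto simp: del_def)
  have mem: "i \<in> del n \<psi> \<tau> ` {1..<j} \<longleftrightarrow> i \<in> \<tau> ` {1..<j}" if "i \<le> n" "j \<le> Suc n" for i j
  proof -
    have "\<psi> (\<tau> l) = i \<longleftrightarrow> \<tau> l = i" if "l \<in> {1..<j}" for l
      using that \<open>i \<le> n\<close> \<open>j \<le> Suc n\<close> by (intro gt) auto
    then show ?thesis
      unfolding im[OF that(2)] image_image image_iff by metis
  qed
  have im': "del n \<psi> \<tau> ` {1..n} = \<psi> ` \<tau> ` {1..n}"
    using im[of "Suc n"] by (simp add: atLeastLessThanSuc_atLeastAtMost)
  have "inj_on (\<psi> \<circ> \<tau>) {1..n}"
    using s(1) \<psi>(3) by (rule comp_inj_on)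
  then have "inj_on (del n \<psi> \<tau>) {1..n}"
    by (rule inj_on_cong[THEN iffD1, rotated]) (auto simp: del_def)
  moreover have "del n \<psi> \<tau> i \<noteq> i \<and> (del n \<psi> \<tau> i > i \<longrightarrow> i \<notin> del n \<psi> \<tau> ` {1..<i})"
    if i: "i \<in> {1..n}" for i
    using i nf[OF i] nc[OF i] gt[of i "\<tau> i"] by (subst mem) (auto simp: del_def)
  ultimately show "partial_perm n h (del n \<psi> \<tau>)"
    unfolding partial_perm_def im' using ran by (auto simp: del_def)
  show "i \<le> n \<Longrightarrow> i \<in> del n \<psi> \<tau> ` {1..n} \<longleftrightarrow> i \<in> \<tau> ` {1..n}"
    using mem[of i "Suc n"] by (simp add: atLeastLessThanSuc_atLeastAtMost)
qed

lemma partial_perm_Suc_dest: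
  assumes "partial_perm (Suc n) h \<tau>"
  shows "\<tau> (Suc n) \<notin> \<tau> ` {1..n}" "\<tau> ` {1..n} \<subseteq> {1..Suc n + h}"
    "{Suc (Suc n)..Suc n + h} - {\<tau> (Suc n)} \<subseteq> \<tau> ` {1..n}"
    "\<tau> (Suc n) \<noteq> Suc n" "\<tau> (Suc n) > Suc n \<Longrightarrow> Suc n \<notin> \<tau> ` {1..n}"
    "\<tau> (Suc n) \<in> {1..Suc n + h}"
proof -
  have S: "{1..Suc n} = insert (Suc n) {1..n}" "{1..<Suc n} = {1..n}"
    by auto
  have s: "inj_on \<tau> {1..Suc n}" "\<tau> ` {1..Suc n} \<subseteq> {1..Suc n + h}"
      "{Suc (Suc n)..Suc n + h} \<subseteq> \<tau> ` {1..Suc n}"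
    and nf: "\<And>i. i \<in> {1..Suc n} \<Longrightarrow> \<tau> i \<noteq> i"
    and nc: "\<And>i. i \<in> {1..Suc n} \<Longrightarrow> \<tau> i > i \<Longrightarrow> i \<notin> \<tau> ` {1..<i}"
    using assms unfolding partial_perm_def by blast+
  show "\<tau> (Suc n) \<notin> \<tau> ` {1..n}"
    using inj_onD[OF s(1), of "Suc n"] by fastforce
  show "\<tau> ` {1..n} \<subseteq> {1..Suc n + h}" "{Suc (Suc n)..Suc n + h} - {\<tau> (Suc n)} \<subseteq> \<tau> ` {1..n}"
    "\<tau> (Suc n) \<in> {1..Suc n + h}"
    using s(2,3) unfolding S by blast+
  show "\<tau> (Suc n) \<noteq> Suc n" "\<tau> (Suc n) > Suc n \<Longrightarrow> Suc n \<notin> \<tau> ` {1..n}"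
    using nf[of "Suc n"] nc[of "Suc n"] unfolding S by auto
qed

section \<open>The three insertions and their inverses\<close>

text \<open>The shifts renumber the placeholders when \<open>n\<close> is increased: \<open>up_shift n r\<close> leaves out
  \<open>n + 1\<close> and the placeholder \<open>n + 2 + r\<close> (which lies above all others if \<open>r = h\<close>), and
  \<open>fall_shift n r\<close> moves the placeholder \<open>n + 1 + r\<close> to \<open>n + 1\<close>, where it becomes a proper value.\<close>

definition up_shift :: "nat \<Rightarrow> nat \<Rightarrow> nat \<Rightarrow> nat" where
  "up_shift n r v = (if v \<le> n then v else if v \<le> n + r then v + 1 else v + 2)"

definition up_unshift :: "nat \<Rightarrow> nat \<Rightarrow> nat \<Rightarrow> nat" where
  "up_unshift n r v = (if v \<le> n then v else if v \<le> Suc n + r then v - 1 else v - 2)"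

definition fall_shift :: "nat \<Rightarrow> nat \<Rightarrow> nat \<Rightarrow> nat" where
  "fall_shift n r v = (if v \<le> n then v else if v \<le> n + r then v + 1
     else if v = Suc n + r then Suc n else v)"

definition fall_unshift :: "nat \<Rightarrow> nat \<Rightarrow> nat \<Rightarrow> nat" where
  "fall_unshift n r v = (if v \<le> n then v else if v = Suc n then Suc n + r
     else if v \<le> Suc n + r then v - 1 else v)"

lemma up_unshift_shift [simp]: "up_unshift n r (up_shift n r v) = v"
  by (auto simp: up_shift_def up_unshift_def)

lemma up_shift_unshift: "v \<noteq> Suc n \<Longrightarrow> v \<noteq> Suc (Suc (n + r)) \<Longrightarrow> up_shift n r (up_unshift n r v) = v"
  by (auto simp: up_shift_def up_unshift_def)

lemma fall_unshift_shift [simp]: "fall_unshift n r (fall_shift n r v) = v"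
  by (auto simp: fall_shift_def fall_unshift_def)

lemma fall_shift_unshift [simp]: "fall_shift n r (fall_unshift n r v) = v"
  by (auto simp: fall_shift_def fall_unshift_def)

lemma up_shift_neq: "up_shift n r v \<noteq> Suc n" "up_shift n r v \<noteq> Suc (Suc (n + r))"
  by (auto simp: up_shift_def)

lemma up_shift_bounds:
  "v \<le> n \<Longrightarrow> up_shift n r v = v" "v > n \<Longrightarrow> up_shift n r v > n"
  "v \<le> n + h \<Longrightarrow> up_shift n r v \<le> Suc (Suc (n + h))"
  "v \<le> n + h \<Longrightarrow> up_shift n h v \<le> Suc (n + h)" "v \<ge> 1 \<Longrightarrow> up_shift n r v \<ge> 1"
  "up_shift n r v \<le> n \<longleftrightarrow> v \<le> n"
  by (auto simp: up_shift_def)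

lemma fall_shift_bounds:
  "v \<le> n \<Longrightarrow> fall_shift n r v = v" "v > n \<Longrightarrow> fall_shift n r v > n"
  "r \<le> h \<Longrightarrow> v \<le> Suc (n + h) \<Longrightarrow> fall_shift n r v \<le> Suc (n + h)"
  "v \<ge> 1 \<Longrightarrow> fall_shift n r v \<ge> 1" "fall_shift n r v \<le> n \<longleftrightarrow> v \<le> n"
  by (auto simp: fall_shift_def)

lemma inj_on_up_shift: "inj_on (up_shift n r) A"
  by (rule inj_on_inverseI[of _ "up_unshift n r"]) simp

lemma inj_on_fall_shift: "inj_on (fall_shift n r) A"
  by (rule inj_on_inverseI[of _ "fall_unshift n r"]) simp

lemma inj_on_fall_unshift: "inj_on (fall_unshift n r) A"
  by (rule inj_on_inverseI[of _ "fall_shift n r"]) simp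

text \<open>The new point is a valley: it becomes open, its image has rank \<open>r\<close> (from 0)
  among the images of the open points, and \<open>n + 1\<close> becomes a missing value.\<close>

lemma partial_perm_rise:
  assumes "partial_perm n h \<tau>" "r \<le> h"
  shows "partial_perm (Suc n) (Suc h) (ins n (up_shift n r) (Suc (Suc (n + r))) \<tau>)"
proof (rule partial_perm_ins[OF assms(1)])
  show "{Suc (Suc n)..Suc n + Suc h} \<subseteq> insert (Suc (Suc (n + r))) (up_shift n r ` {Suc n..n + h})"
  proof
    fix v assume v: "v \<in> {Suc (Suc n)..Suc n + Suc h}"
    show "v \<in> insert (Suc (Suc (n + r))) (up_shift n r ` {Suc n..n + h})"
    proof (cases "v = Suc (Suc (n + r))")
      case False
      then have "v = up_shift n r (up_unshift n r v)" "up_unshift n r v \<in> {Suc n..n + h}"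
        using v assms(2) by (auto simp: up_shift_def up_unshift_def)
      then show ?thesis by blast
    qed simp
  qed
  show "Suc (Suc (n + r)) \<notin> up_shift n r ` \<tau> ` {1..n}"
    by (rule notI, elim imageE) (metis up_shift_neq(2))
  show "Suc n \<notin> up_shift n r ` {Suc n..n + h}"
    by (rule notI, elim imageE) (metis up_shift_neq(1))
  show "up_shift n r ` {Suc n..n + h} \<subseteq> {1..Suc n + Suc h}"
  proof (rule image_subsetI)
    fix v assume "v \<in> {Suc n..n + h}"
    then show "up_shift n r v \<in> {1..Suc n + Suc h}"
      using up_shift_bounds(3)[of v n h r] up_shift_bounds(5)[of v n r] by simp
  qed
qed (use assms(2) in \<open>simp_all add: up_shift_bounds inj_on_up_shift\<close>)

text \<open>The new point is a cycle double fall: \<open>m\<close> receives its preimage and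
  \<open>n + 1\<close> becomes missing in its place, so the height is unchanged.\<close>

lemma partial_perm_level:
  assumes "partial_perm n h \<tau>" "m \<in> missing n \<tau>"
  shows "partial_perm (Suc n) h (ins n (up_shift n h) m \<tau>)"
proof (rule partial_perm_ins[OF assms(1)])
  show "m \<notin> up_shift n h ` \<tau> ` {1..n}"
  proof
    assume "m \<in> up_shift n h ` \<tau> ` {1..n}"
    then obtain v where v: "v \<in> \<tau> ` {1..n}" "m = up_shift n h v" by blast
    with assms(2) have "v \<le> n" "m = v"
      using up_shift_bounds by (auto simp: missing_def)
    with v(1) assms(2) show False by (simp add: missing_def)
  qed
  show "up_shift n h ` {Suc n..n + h} \<subseteq> {1..Suc n + h}"
  proof (rule image_subsetI)
    fix v assume "v \<in> {Suc n..n + h}"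
    then show "up_shift n h v \<in> {1..Suc n + h}"
      using up_shift_bounds(4)[of v n h] up_shift_bounds(5)[of v n h] by simp
  qed
  have "m \<le> n" "1 \<le> m"
    using assms(2) by (auto simp: missing_def)
  then show "m \<noteq> Suc n" "m \<in> {1..Suc n + h}" "m > Suc n \<Longrightarrow> Suc n \<notin> up_shift n h ` {Suc n..n + h}"
    by auto
  show "{Suc (Suc n)..Suc n + h} \<subseteq> insert m (up_shift n h ` {Suc n..n + h})"
  proof
    fix v assume v: "v \<in> {Suc (Suc n)..Suc n + h}"
    then have "v = up_shift n h (up_unshift n h v)" "up_unshift n h v \<in> {Suc n..n + h}"
      by (auto simp: up_shift_def up_unshift_def)
    then show "v \<in> insert m (up_shift n h ` {Suc n..n + h})" by blast
  qed
qed (simp_all add: up_shift_bounds inj_on_up_shift)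

text \<open>The new point is a peak: it takes the missing value \<open>m\<close>, and the open point
  with placeholder \<open>n + 1 + r\<close> is closed by mapping it to \<open>n + 1\<close>.\<close>

lemma partial_perm_fall:
  assumes "partial_perm n (Suc h) \<tau>" "m \<in> missing n \<tau>" "r \<le> h"
  shows "partial_perm (Suc n) h (ins n (fall_shift n r) m \<tau>)"
proof (rule partial_perm_ins[OF assms(1)])
  show "m \<notin> fall_shift n r ` \<tau> ` {1..n}"
  proof
    assume "m \<in> fall_shift n r ` \<tau> ` {1..n}"
    then obtain v where v: "v \<in> \<tau> ` {1..n}" "m = fall_shift n r v" by blast
    with assms(2) have "v \<le> n" "m = v"
      using fall_shift_bounds by (auto simp: missing_def)
    with v(1) assms(2) show False by (simp add: missing_def)
  qed
  show "fall_shift n r ` {Suc n..n + Suc h} \<subseteq> {1..Suc n + h}"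
  proof (rule image_subsetI)
    fix v assume "v \<in> {Suc n..n + Suc h}"
    then show "fall_shift n r v \<in> {1..Suc n + h}"
      using fall_shift_bounds(3)[OF assms(3), of v n] fall_shift_bounds(4)[of v n r] by simp
  qed
  have "m \<le> n" "1 \<le> m"
    using assms(2) by (auto simp: missing_def)
  then show "m \<noteq> Suc n" "m \<in> {1..Suc n + h}" "m > Suc n \<Longrightarrow> Suc n \<notin> fall_shift n r ` {Suc n..n + Suc h}"
    by auto
  show "{Suc (Suc n)..Suc n + h} \<subseteq> insert m (fall_shift n r ` {Suc n..n + Suc h})"
  proof
    fix v assume v: "v \<in> {Suc (Suc n)..Suc n + h}"
    then have "fall_unshift n r v \<in> {Suc n..n + Suc h}"
      using assms(3) by (auto simp: fall_unshift_def)
    then have "fall_shift n r (fall_unshift n r v) \<in> fall_shift n r ` {Suc n..n + Suc h}"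
      by (rule imageI)
    then show "v \<in> insert m (fall_shift n r ` {Suc n..n + Suc h})" by simp
  qed
qed (simp_all add: fall_shift_bounds inj_on_fall_shift)

text \<open>Old points avoid \<open>n + 1\<close> because there is no cycle double rise, and avoid
  the value of \<open>n + 1\<close> by injectivity. These are the two numbers at which
  \<open>up_shift\<close> does not undo \<open>up_unshift\<close>.\<close>

lemma partial_perm_unrise:
  assumes "partial_perm (Suc n) (Suc h) \<tau>" "\<tau> (Suc n) = Suc (Suc (n + r))"
  shows "partial_perm n h (del n (up_unshift n r) \<tau>)"
    and "ins n (up_shift n r) (Suc (Suc (n + r))) (del n (up_unshift n r) \<tau>) = \<tau>"
    and "r \<le> h"
proof -
  note d = partial_perm_Suc_dest[OF assms(1)]
  have "Suc n \<notin> \<tau> ` {1..n}"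
    by (rule d(5)) (simp add: assms(2))
  then have ne: "v \<noteq> Suc n" "v \<noteq> Suc (Suc (n + r))" if "v \<in> \<tau> ` {1..n}" for v
    using that d(1) unfolding assms(2) by blast+
  have bnd: "v \<in> {1..Suc n + Suc h}" if "v \<in> \<tau> ` {1..n}" for v
    using d(2) that by blast
  show r: "r \<le> h"
    using d(6) assms(2) by auto
  show "partial_perm n h (del n (up_unshift n r) \<tau>)"
  proof (rule partial_perm_del(1)[OF assms(1)])
    show "inj_on (up_unshift n r) (\<tau> ` {1..n})"
      by (rule inj_on_inverseI[of _ "up_shift n r"]) (use ne in \<open>simp add: up_shift_unshift\<close>)
    show "up_unshift n r ` \<tau> ` {1..n} \<subseteq> {1..n + h}"
    proof
      fix u assume "u \<in> up_unshift n r ` \<tau> ` {1..n}"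
      then obtain v where v: "v \<in> \<tau> ` {1..n}" "u = up_unshift n r v" by blast
      then show "u \<in> {1..n + h}"
        using ne[OF v(1)] bnd[OF v(1)] r by (auto simp: up_unshift_def)
    qed
    show "{Suc n..n + h} \<subseteq> up_unshift n r ` \<tau> ` {1..n}"
    proof
      fix v assume v: "v \<in> {Suc n..n + h}"
      then have "up_shift n r v \<in> {Suc (Suc n)..Suc n + Suc h} - {\<tau> (Suc n)}"
        using assms(2) by (auto simp: up_shift_def)
      then have "up_unshift n r (up_shift n r v) \<in> up_unshift n r ` \<tau> ` {1..n}"
        using d(3) by blast
      then show "v \<in> up_unshift n r ` \<tau> ` {1..n}" by simp
    qed
    fix v assume "v \<in> \<tau> ` {1..n}" "v > n"
    with ne[OF this(1)] show "n < up_unshift n r v"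
      by (auto simp: up_unshift_def)
  qed (simp add: up_unshift_def)
  have "ins n (up_shift n r) (\<tau> (Suc n)) (del n (up_unshift n r) \<tau>) = \<tau>"
    by (rule ins_del[OF assms(1)]) (use ne in \<open>simp add: up_shift_unshift\<close>)
  then show "ins n (up_shift n r) (Suc (Suc (n + r))) (del n (up_unshift n r) \<tau>) = \<tau>"
    by (simp add: assms(2))
qed

lemma partial_perm_unlevel:
  assumes "partial_perm (Suc n) h \<tau>" "\<tau> (Suc n) \<le> n" "Suc n \<notin> \<tau> ` {1..n}"
  shows "partial_perm n h (del n (up_unshift n h) \<tau>)"
    and "\<tau> (Suc n) \<in> missing n (del n (up_unshift n h) \<tau>)"
    and "ins n (up_shift n h) (\<tau> (Suc n)) (del n (up_unshift n h) \<tau>) = \<tau>"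
proof -
  note d = partial_perm_Suc_dest[OF assms(1)]
  have bnd: "v \<in> {1..Suc n + h}" if "v \<in> \<tau> ` {1..n}" for v
    using d(2) that by blast
  have ne: "v \<noteq> Suc n" "v \<noteq> Suc (Suc n) + h" if "v \<in> \<tau> ` {1..n}" for v
    using that assms(3) bnd[OF that] by (blast, simp)
  have c3: "inj_on (up_unshift n h) (\<tau> ` {1..n})"
    by (rule inj_on_inverseI[of _ "up_shift n h"]) (use ne in \<open>simp add: up_shift_unshift\<close>)
  have c4: "up_unshift n h ` \<tau> ` {1..n} \<subseteq> {1..n + h}"
  proof
    fix u assume "u \<in> up_unshift n h ` \<tau> ` {1..n}"
    then obtain v where v: "v \<in> \<tau> ` {1..n}" "u = up_unshift n h v" by blast
    then show "u \<in> {1..n + h}"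
      using ne[OF v(1)] bnd[OF v(1)] by (auto simp: up_unshift_def)
  qed
  have c5: "{Suc n..n + h} \<subseteq> up_unshift n h ` \<tau> ` {1..n}"
  proof
    fix v assume v: "v \<in> {Suc n..n + h}"
    then have "up_shift n h v \<in> {Suc (Suc n)..Suc n + h} - {\<tau> (Suc n)}"
      using assms(2) by (auto simp: up_shift_def)
    then have "up_shift n h v \<in> \<tau> ` {1..n}"
      using d(3) by blast
    then have "up_unshift n h (up_shift n h v) \<in> up_unshift n h ` \<tau> ` {1..n}"
      by (rule imageI)
    then show "v \<in> up_unshift n h ` \<tau> ` {1..n}" by simp
  qed
  have c2: "n < up_unshift n h v" if "v \<in> \<tau> ` {1..n}" "v > n" for v
    using that ne[OF that(1)] by (auto simp: up_unshift_def)
  have c1: "up_unshift n h v = v" if "v \<le> n" for v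
    using that by (simp add: up_unshift_def)
  note del = partial_perm_del[of n h \<tau> "up_unshift n h" h, OF assms(1) c1 c2 c3 c4 c5]
  show "partial_perm n h (del n (up_unshift n h) \<tau>)"
    by (rule del(1))
  show "\<tau> (Suc n) \<in> missing n (del n (up_unshift n h) \<tau>)"
    using del(2)[of "\<tau> (Suc n)"] d(1,6) assms(2) by (simp add: missing_def)
  show "ins n (up_shift n h) (\<tau> (Suc n)) (del n (up_unshift n h) \<tau>) = \<tau>"
    by (rule ins_del[OF assms(1)]) (use ne in \<open>simp add: up_shift_unshift\<close>)
qed

lemma partial_perm_unfall:
  assumes "partial_perm (Suc n) h \<tau>" "\<tau> (Suc n) \<le> n" "Suc n \<in> \<tau> ` {1..n}" "r \<le> h"
  shows "partial_perm n (Suc h) (del n (fall_unshift n r) \<tau>)"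
    and "\<tau> (Suc n) \<in> missing n (del n (fall_unshift n r) \<tau>)"
    and "ins n (fall_shift n r) (\<tau> (Suc n)) (del n (fall_unshift n r) \<tau>) = \<tau>"
proof -
  note d = partial_perm_Suc_dest[OF assms(1)]
  have bnd: "v \<in> {1..Suc n + h}" if "v \<in> \<tau> ` {1..n}" for v
    using d(2) that by blast
  have c3: "inj_on (fall_unshift n r) (\<tau> ` {1..n})"
    by (rule inj_on_fall_unshift)
  have c4: "fall_unshift n r ` \<tau> ` {1..n} \<subseteq> {1..n + Suc h}"
  proof
    fix u assume "u \<in> fall_unshift n r ` \<tau> ` {1..n}"
    then obtain v where v: "v \<in> \<tau> ` {1..n}" "u = fall_unshift n r v" by blast
    then show "u \<in> {1..n + Suc h}"
      using bnd[OF v(1)] assms(4) by (auto simp: fall_unshift_def)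
  qed
  have c5: "{Suc n..n + Suc h} \<subseteq> fall_unshift n r ` \<tau> ` {1..n}"
  proof
    fix v assume v: "v \<in> {Suc n..n + Suc h}"
    then have "fall_shift n r v \<in> insert (Suc n) ({Suc (Suc n)..Suc n + h} - {\<tau> (Suc n)})"
      using assms(2,4) by (auto simp: fall_shift_def)
    then have "fall_shift n r v \<in> \<tau> ` {1..n}"
      using d(3) assms(3) by (metis insertE subsetD)
    then have "fall_unshift n r (fall_shift n r v) \<in> fall_unshift n r ` \<tau> ` {1..n}"
      by (rule imageI)
    then show "v \<in> fall_unshift n r ` \<tau> ` {1..n}" by simp
  qed
  have c2: "n < fall_unshift n r v" if "v \<in> \<tau> ` {1..n}" "v > n" for v
    using that by (auto simp: fall_unshift_def)
  have c1: "fall_unshift n r v = v" if "v \<le> n" for v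
    using that by (simp add: fall_unshift_def)
  note del = partial_perm_del[of n h \<tau> "fall_unshift n r" "Suc h", OF assms(1) c1 c2 c3 c4 c5]
  show "partial_perm n (Suc h) (del n (fall_unshift n r) \<tau>)"
    by (rule del(1))
  show "\<tau> (Suc n) \<in> missing n (del n (fall_unshift n r) \<tau>)"
    using del(2)[of "\<tau> (Suc n)"] d(1,6) assms(2) by (simp add: missing_def)
  show "ins n (fall_shift n r) (\<tau> (Suc n)) (del n (fall_unshift n r) \<tau>) = \<tau>"
    by (rule ins_del[OF assms(1)]) simp
qed

lemma partial_perm_inj: "partial_perm n h \<tau> \<Longrightarrow> inj_on \<tau> {1..n}"
  unfolding partial_perm_def by blast

lemma partial_perm_bound: "partial_perm n h \<tau> \<Longrightarrow> i \<in> {1..n} \<Longrightarrow> \<tau> i \<in> {1..n + h}"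
  unfolding partial_perm_def by blast

lemma partial_perm_ex: "partial_perm n h \<tau> \<Longrightarrow> v \<in> {Suc n..n + h} \<Longrightarrow> \<exists>i\<in>{1..n}. \<tau> i = v"
  unfolding partial_perm_def by (metis imageE subsetD)

lemma ins_Suc [simp]: "ins n \<phi> x \<tau> (Suc n) = x"
  by (simp add: ins_def)

lemma ins_le: "i \<in> {1..n} \<Longrightarrow> ins n \<phi> x \<tau> i = \<phi> (\<tau> i)"
  by (simp add: ins_def)

lemma ins_image_le: "ins n \<phi> x \<tau> ` {1..n} = \<phi> ` \<tau> ` {1..n}"
  using ins_image_less[of "Suc n" n] by (simp add: atLeastLessThanSuc_atLeastAtMost)

section \<open>Insertions as bijections and the resulting recursion for sums\<close>

abbreviation rise :: "nat \<Rightarrow> nat \<Rightarrow> (nat \<Rightarrow> nat) \<Rightarrow> nat \<Rightarrow> nat" where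
  "rise n r \<equiv> ins n (up_shift n r) (Suc (Suc (n + r)))"

abbreviation level :: "nat \<Rightarrow> nat \<Rightarrow> nat \<Rightarrow> (nat \<Rightarrow> nat) \<Rightarrow> nat \<Rightarrow> nat" where
  "level n h m \<equiv> ins n (up_shift n h) m"

abbreviation fall :: "nat \<Rightarrow> nat \<Rightarrow> nat \<Rightarrow> (nat \<Rightarrow> nat) \<Rightarrow> nat \<Rightarrow> nat" where
  "fall n r m \<equiv> ins n (fall_shift n r) m"

lemma Suc_notin_level: "Suc n \<notin> level n h m \<tau> ` {1..n}"
  unfolding ins_image_le by (rule notI, elim imageE) (metis up_shift_neq(1))

lemma Suc_in_fall:
  assumes "partial_perm n (Suc h) \<tau>" "r \<le> h"
  shows "Suc n \<in> fall n r m \<tau> ` {1..n}"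
proof -
  have "Suc n + r \<in> {Suc n..n + Suc h}"
    using assms(2) by simp
  then have "Suc n + r \<in> \<tau> ` {1..n}"
    using partial_perm_ex[OF assms(1)] by (metis imageI)
  then have "fall_shift n r (Suc n + r) \<in> fall_shift n r ` \<tau> ` {1..n}"
    by (rule imageI)
  then show ?thesis
    unfolding ins_image_le by (simp add: fall_shift_def)
qed

text \<open>Valley, cycle double fall or peak. A fixed point at \<open>n + 1\<close> is excluded,
  and an excedance there is never the image of an old point, so only the non-excedances have to be
  split.\<close>

lemma sum_partial_perms_cases:
  assumes "S \<subseteq> Collect (partial_perm (Suc n) h)"
  shows "sum g S = sum g {\<tau>\<in>S. Suc n < \<tau> (Suc n)} +
    sum g {\<tau>\<in>S. \<tau> (Suc n) \<le> n \<and> Suc n \<notin> \<tau> ` {1..n}} +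
    (sum g {\<tau>\<in>S. \<tau> (Suc n) \<le> n \<and> Suc n \<in> \<tau> ` {1..n}} :: 'a::comm_monoid_add)"
    (is "_ = sum g ?R + sum g ?L + sum g ?F")
proof -
  have [simp]: "finite S"
    using assms finite_partial_perms[of "Suc n" h] by (rule finite_subset)
  have "S = (?R \<union> ?L) \<union> ?F"
  proof -
    have "\<tau> (Suc n) > Suc n \<or> \<tau> (Suc n) \<le> n" if "\<tau> \<in> S" for \<tau>
    proof -
      have "partial_perm (Suc n) h \<tau>"
        using that assms by blast
      from partial_perm_Suc_dest(4)[OF this] show ?thesis by linarith
    qed
    then show ?thesis by blast
  qed
  then have "sum g S = sum g ((?R \<union> ?L) \<union> ?F)"
    by (rule arg_cong)
  also have "\<dots> = sum g (?R \<union> ?L) + sum g ?F"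
    by (rule sum.union_disjoint) auto
  also have "sum g (?R \<union> ?L) = sum g ?R + sum g ?L"
    by (rule sum.union_disjoint) auto
  finally show ?thesis .
qed

text \<open>In the applications \<open>p\<close> recovers the smaller object and \<open>q\<close>
  the choice made in the insertion.\<close>

lemma sum_reindex_Sigma:
  assumes "finite A" "\<And>a. a \<in> A \<Longrightarrow> finite (B a)"
    and "\<And>a b. a \<in> A \<Longrightarrow> b \<in> B a \<Longrightarrow> f a b \<in> C \<and> p (f a b) = a \<and> q (f a b) = b"
    and "\<And>c. c \<in> C \<Longrightarrow> p c \<in> A \<and> q c \<in> B (p c) \<and> f (p c) (q c) = c"
  shows "sum g C = (\<Sum>a\<in>A. \<Sum>b\<in>B a. g (f a b))"
proof -
  have "sum g C = (\<Sum>(a, b)\<in>Sigma A B. g (f a b))"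
    by (rule sum.reindex_bij_witness[of _ "\<lambda>(a, b). f a b" "\<lambda>c. (p c, q c)"]) (use assms(3,4) in auto)
  also have "\<dots> = (\<Sum>a\<in>A. \<Sum>b\<in>B a. g (f a b))"
    using assms(1,2) by (subst sum.Sigma) auto
  finally show ?thesis .
qed

lemma rise_bij:
  assumes "\<tau> \<in> Collect (partial_perm n h)" "r \<in> {..h}"
  shows "rise n r \<tau> \<in> {\<tau>. partial_perm (Suc n) (Suc h) \<tau> \<and> Suc n < \<tau> (Suc n)} \<and>
    del n (up_unshift n (rise n r \<tau> (Suc n) - Suc (Suc n))) (rise n r \<tau>) = \<tau> \<and>
    rise n r \<tau> (Suc n) - Suc (Suc n) = r"
  using assms partial_perm_rise[of n h \<tau> r] del_ins[of n h \<tau> "up_unshift n r"] by simp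

lemma rise_bij':
  assumes "\<tau> \<in> {\<tau>. partial_perm (Suc n) (Suc h) \<tau> \<and> Suc n < \<tau> (Suc n)}"
  defines "r \<equiv> \<tau> (Suc n) - Suc (Suc n)"
  shows "del n (up_unshift n r) \<tau> \<in> Collect (partial_perm n h) \<and> r \<in> {..h} \<and>
    rise n r (del n (up_unshift n r) \<tau>) = \<tau>"
proof -
  have "\<tau> (Suc n) = Suc (Suc (n + r))"
    using assms(1) unfolding mem_Collect_eq r_def by linarith
  then show ?thesis
    using assms(1) partial_perm_unrise[of n h \<tau> r] by simp
qed

lemma level_bij:
  assumes "\<tau> \<in> Collect (partial_perm n h)" "m \<in> missing n \<tau>"
  shows "level n h m \<tau> \<in> {\<tau>. partial_perm (Suc n) h \<tau> \<and> \<tau> (Suc n) \<le> n \<and> Suc n \<notin> \<tau> ` {1..n}} \<and>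
    del n (up_unshift n h) (level n h m \<tau>) = \<tau> \<and> level n h m \<tau> (Suc n) = m"
proof -
  have "m \<le> n"
    using assms(2) by (simp add: missing_def)
  then show ?thesis
    using assms partial_perm_level[of n h \<tau> m] del_ins[of n h \<tau> "up_unshift n h"] Suc_notin_level[of n h m \<tau>]
    by simp
qed

lemma level_bij':
  assumes "\<tau> \<in> {\<tau>. partial_perm (Suc n) h \<tau> \<and> \<tau> (Suc n) \<le> n \<and> Suc n \<notin> \<tau> ` {1..n}}"
  shows "del n (up_unshift n h) \<tau> \<in> Collect (partial_perm n h) \<and>
    \<tau> (Suc n) \<in> missing n (del n (up_unshift n h) \<tau>) \<and>
    level n h (\<tau> (Suc n)) (del n (up_unshift n h) \<tau>) = \<tau>"
  using assms partial_perm_unlevel[of n h \<tau>] by simp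

lemma fall_bij:
  assumes "\<tau> \<in> Collect (partial_perm n (Suc h))" "m \<in> missing n \<tau>" "r \<le> h"
  shows "fall n r m \<tau> \<in> {\<tau>. partial_perm (Suc n) h \<tau> \<and> \<tau> (Suc n) \<le> n \<and> Suc n \<in> \<tau> ` {1..n}} \<and>
    del n (fall_unshift n r) (fall n r m \<tau>) = \<tau> \<and> fall n r m \<tau> (Suc n) = m"
proof -
  have "m \<le> n"
    using assms(2) by (simp add: missing_def)
  then show ?thesis
    using assms partial_perm_fall[of n h \<tau> m r] del_ins[of n "Suc h" \<tau> "fall_unshift n r"] Suc_in_fall[of n h \<tau> r m]
    by simp
qed

lemma fall_bij':
  assumes "\<tau> \<in> {\<tau>. partial_perm (Suc n) h \<tau> \<and> \<tau> (Suc n) \<le> n \<and> Suc n \<in> \<tau> ` {1..n}}" "r \<le> h"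
  shows "del n (fall_unshift n r) \<tau> \<in> Collect (partial_perm n (Suc h)) \<and>
    \<tau> (Suc n) \<in> missing n (del n (fall_unshift n r) \<tau>) \<and>
    fall n r (\<tau> (Suc n)) (del n (fall_unshift n r) \<tau>) = \<tau>"
  using assms partial_perm_unfall[of n h \<tau> r] by simp

lemma finite_missing [simp]: "finite (missing n \<tau>)"
  by (simp add: missing_def)

text \<open>The order of the future images is already fixed here, so the open point closed by a peak
  is the one with the smallest placeholder: \<open>r = 0\<close> in the falls.\<close>

lemma sum_partial_perms_Suc:
  "sum g (Collect (partial_perm (Suc n) h)) =
    (if h = 0 then 0 else \<Sum>\<tau>\<in>Collect (partial_perm n (h - 1)). \<Sum>r\<le>h - 1. g (rise n r \<tau>)) +
    (\<Sum>\<tau>\<in>Collect (partial_perm n h). \<Sum>m\<in>missing n \<tau>. g (level n h m \<tau>)) +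
    (\<Sum>\<tau>\<in>Collect (partial_perm n (Suc h)). \<Sum>m\<in>missing n \<tau>. g (fall n 0 m \<tau>) :: 'a::comm_monoid_add)"
proof -
  have "sum g {\<tau>. partial_perm (Suc n) h \<tau> \<and> Suc n < \<tau> (Suc n)} =
    (if h = 0 then 0 else \<Sum>\<tau>\<in>Collect (partial_perm n (h - 1)). \<Sum>r\<le>h - 1. g (rise n r \<tau>))"
  proof (cases h)
    case 0
    have e: "{\<tau>. partial_perm (Suc n) 0 \<tau> \<and> Suc n < \<tau> (Suc n)} = {}"
      using partial_perm_Suc_dest(6)[of n 0] by fastforce
    show ?thesis unfolding 0 e by simp
  next
    case (Suc h')
    have "sum g {\<tau>. partial_perm (Suc n) (Suc h') \<tau> \<and> Suc n < \<tau> (Suc n)} =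
        (\<Sum>\<tau>\<in>Collect (partial_perm n h'). \<Sum>r\<in>{..h'}. g (rise n r \<tau>))"
      by (rule sum_reindex_Sigma[OF _ _ rise_bij rise_bij']) (simp_all add: finite_partial_perms)
    then show ?thesis using Suc by simp
  qed
  moreover have "sum g {\<tau>. partial_perm (Suc n) h \<tau> \<and> \<tau> (Suc n) \<le> n \<and> Suc n \<notin> \<tau> ` {1..n}} =
      (\<Sum>\<tau>\<in>Collect (partial_perm n h). \<Sum>m\<in>missing n \<tau>. g (level n h m \<tau>))"
    by (rule sum_reindex_Sigma[OF _ _ level_bij level_bij']) (simp_all add: finite_partial_perms)
  moreover have "sum g {\<tau>. partial_perm (Suc n) h \<tau> \<and> \<tau> (Suc n) \<le> n \<and> Suc n \<in> \<tau> ` {1..n}} =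
      (\<Sum>\<tau>\<in>Collect (partial_perm n (Suc h)). \<Sum>m\<in>missing n \<tau>. g (fall n 0 m \<tau>))"
    by (rule sum_reindex_Sigma[OF _ _ fall_bij fall_bij']) (simp_all add: finite_partial_perms)
  ultimately show ?thesis
    by (subst sum_partial_perms_cases[OF subset_refl]) simp
qed

section \<open>Open points without an order of their images\<close>

text \<open>Partial permutations with increasing placeholders represent those whose open points are not
  ordered.  For them the order of the images of the open points is decided not when a point is
  opened but when it is closed, by the choice of \<open>r\<close> in \<open>fall n r m\<close>.\<close>

definition incr :: "nat \<Rightarrow> (nat \<Rightarrow> nat) \<Rightarrow> bool" where
  "incr n \<tau> \<longleftrightarrow> (\<forall>i j. 1 \<le> i \<longrightarrow> i < j \<longrightarrow> j \<le> n \<longrightarrow> n < \<tau> i \<longrightarrow> n < \<tau> j \<longrightarrow> \<tau> i < \<tau> j)"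

lemma incrD: "incr n \<tau> \<Longrightarrow> 1 \<le> i \<Longrightarrow> i < j \<Longrightarrow> j \<le> n \<Longrightarrow> n < \<tau> i \<Longrightarrow> n < \<tau> j \<Longrightarrow> \<tau> i < \<tau> j"
  by (simp add: incr_def)

text \<open>Increasing placeholders number the open points by position, starting with
  \<open>n + 1\<close>. Thus placeholders can be reconstructed from positions.\<close>

lemma card_open_less:
  assumes "partial_perm n h \<tau>" "incr n \<tau>" "s \<in> {1..n}" "\<tau> s > n"
  shows "card {i\<in>{1..<s}. n < \<tau> i} = \<tau> s - Suc n"
proof -
  have "bij_betw \<tau> {i\<in>{1..<s}. n < \<tau> i} {Suc n..<\<tau> s}"
  proof (rule bij_betw_imageI)
    have "inj_on \<tau> {1..n}"
      using assms(1) by (rule partial_perm_inj)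
    then show "inj_on \<tau> {i\<in>{1..<s}. n < \<tau> i}"
      by (rule inj_on_subset) (use assms(3) in auto)
    show "\<tau> ` {i\<in>{1..<s}. n < \<tau> i} = {Suc n..<\<tau> s}"
    proof (intro equalityI subsetI)
      fix v assume "v \<in> \<tau> ` {i\<in>{1..<s}. n < \<tau> i}"
      then obtain i where "1 \<le> i" "i < s" "n < \<tau> i" "v = \<tau> i" by auto
      then show "v \<in> {Suc n..<\<tau> s}"
        using incrD[OF assms(2), of i s] assms(3,4) by simp
    next
      fix v assume v: "v \<in> {Suc n..<\<tau> s}"
      have "\<tau> s \<le> n + h"
        using partial_perm_bound[OF assms(1,3)] by simp
      then have "v \<in> {Suc n..n + h}"
        using v by simp
      then obtain i where i: "i \<in> {1..n}" "v = \<tau> i"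
        using partial_perm_ex[OF assms(1)] by blast
      moreover have "i < s"
        using incrD[OF assms(2), of s i] assms(3,4) i v by (cases i s rule: linorder_cases) auto
      ultimately show "v \<in> \<tau> ` {i\<in>{1..<s}. n < \<tau> i}"
        using v by auto
    qed
  qed
  then show ?thesis
    using bij_betw_same_card by fastforce
qed

lemma up_shift_less_iff: "up_shift n r u < up_shift n r v \<longleftrightarrow> u < v"
  by (auto simp: up_shift_def)

lemma up_shift_gt_iff: "Suc n < up_shift n r v \<longleftrightarrow> n < v"
  by (auto simp: up_shift_def)

lemma incr_level:
  assumes "m \<le> n"
  shows "incr (Suc n) (level n h m \<tau>) \<longleftrightarrow> incr n \<tau>"
  using assms by (auto simp: incr_def ins_def up_shift_less_iff up_shift_gt_iff le_Suc_eq)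

text \<open>The new point is the last open point, so it must receive the largest
  placeholder.\<close>

lemma incr_rise:
  assumes "partial_perm n h \<tau>" "r \<le> h"
  shows "incr (Suc n) (rise n r \<tau>) \<longleftrightarrow> r = h \<and> incr n \<tau>"
proof
  assume *: "incr (Suc n) (rise n r \<tau>)"
  have "r = h"
  proof (rule ccontr)
    assume "r \<noteq> h"
    then have "n + h \<in> {Suc n..n + h}"
      using assms(2) by simp
    then obtain i where i: "i \<in> {1..n}" "\<tau> i = n + h"
      using partial_perm_ex[OF assms(1)] by blast
    then show False
      using incrD[OF *, of i "Suc n"] \<open>r \<noteq> h\<close> assms(2) by (simp add: ins_le up_shift_def)
  qed
  moreover have "incr n \<tau>"
    unfolding incr_def
  proof (intro allI impI)
    fix i j assume "1 \<le> i" "i < j" "j \<le> n" "n < \<tau> i" "n < \<tau> j"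
    then show "\<tau> i < \<tau> j"
      using incrD[OF *, of i j] by (simp add: ins_le up_shift_less_iff up_shift_gt_iff)
  qed
  ultimately show "r = h \<and> incr n \<tau>" ..
next
  assume *: "r = h \<and> incr n \<tau>"
  show "incr (Suc n) (rise n r \<tau>)"
    unfolding incr_def
  proof (intro allI impI)
    fix i j assume ij: "1 \<le> i" "i < j" "j \<le> Suc n" "Suc n < rise n r \<tau> i" "Suc n < rise n r \<tau> j"
    then have i: "i \<in> {1..n}" by simp
    have "\<tau> i \<in> {1..n + h}"
      using assms(1) i by (rule partial_perm_bound)
    then have "up_shift n r (\<tau> i) < Suc (Suc (n + r))"
      using * by (simp add: up_shift_def)
    then show "rise n r \<tau> i < rise n r \<tau> j"
      using ij i incrD[of n \<tau> i j] * by (cases "j = Suc n") (auto simp: ins_le up_shift_less_iff up_shift_gt_iff)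
  qed
qed

lemma fall_shift_gt_iff: "Suc n < fall_shift n r v \<longleftrightarrow> n < v \<and> v \<noteq> Suc n + r"
  by (auto simp: fall_shift_def)

lemma fall_shift_less_iff:
  "u \<noteq> Suc n + r \<Longrightarrow> v \<noteq> Suc n + r \<Longrightarrow> fall_shift n r u < fall_shift n r v \<longleftrightarrow> u < v"
  by (auto simp: fall_shift_def)

lemma incr_fall:
  assumes "incr n \<tau>" "m \<le> n"
  shows "incr (Suc n) (fall n r m \<tau>)"
  unfolding incr_def
proof (intro allI impI)
  fix i j assume ij: "1 \<le> i" "i < j" "j \<le> Suc n" "Suc n < fall n r m \<tau> i" "Suc n < fall n r m \<tau> j"
  then have "j \<noteq> Suc n"
    using assms(2) by auto
  then show "fall n r m \<tau> i < fall n r m \<tau> j"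
    using ij incrD[OF assms(1), of i j] by (simp add: ins_le fall_shift_less_iff fall_shift_gt_iff)
qed

text \<open>Recovers \<open>r\<close> after a fall. The placeholder itself has been overwritten by
  \<open>n + 1\<close>, so its rank is read off from the position of its holder among the points
  that are still open.\<close>

definition source_rank :: "nat \<Rightarrow> (nat \<Rightarrow> nat) \<Rightarrow> nat" where
  "source_rank n \<tau> = card {i\<in>{1..<inv_into {1..n} \<tau> (Suc n)}. Suc n < \<tau> i}"

lemma source_rank_fall:
  assumes "partial_perm n (Suc h) \<tau>" "incr n \<tau>" "m \<in> missing n \<tau>" "r \<le> h"
  shows "source_rank n (fall n r m \<tau>) = r"
proof -
  have inj: "inj_on \<tau> {1..n}"
    using assms(1) by (rule partial_perm_inj)
  have "Suc n + r \<in> {Suc n..n + Suc h}"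
    using assms(4) by simp
  then obtain s where s: "s \<in> {1..n}" "\<tau> s = Suc n + r"
    using partial_perm_ex[OF assms(1)] by blast
  have "partial_perm (Suc n) h (fall n r m \<tau>)"
    using assms by (intro partial_perm_fall)
  then have "inj_on (fall n r m \<tau>) {1..Suc n}"
    by (rule partial_perm_inj)
  then have "inj_on (fall n r m \<tau>) {1..n}"
    by (rule inj_on_subset) auto
  then have inv: "inv_into {1..n} (fall n r m \<tau>) (Suc n) = s"
    by (rule inv_into_f_eq) (use s in \<open>simp_all add: ins_le fall_shift_def\<close>)
  have "{i\<in>{1..<s}. Suc n < fall n r m \<tau> i} = {i\<in>{1..<s}. n < \<tau> i}"
  proof (rule Collect_cong, rule conj_cong[OF refl])
    fix i assume i: "i \<in> {1..<s}"
    then have "\<tau> i \<noteq> \<tau> s"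
      using inj_onD[OF inj, of i s] s(1) by auto
    then show "Suc n < fall n r m \<tau> i \<longleftrightarrow> n < \<tau> i"
      using i s by (simp add: ins_le fall_shift_gt_iff)
  qed
  then have "source_rank n (fall n r m \<tau>) = card {i\<in>{1..<s}. n < \<tau> i}"
    by (simp only: source_rank_def inv)
  also have "\<dots> = r"
    using card_open_less[OF assms(1,2) s(1)] s(2) by simp
  finally show ?thesis .
qed

text \<open>The reopened point \<open>s\<close> needs a placeholder between those of the open points
  before and after it. By \<open>val\<close> positions determine placeholders, and
  \<open>below\<close> and \<open>above\<close> show that \<open>n + 1 + r\<close> fits after the
  renumbering.\<close>

lemma source_rank_properties:
  assumes st: "partial_perm (Suc n) h \<tau>" and inc: "incr (Suc n) \<tau>" and "\<tau> (Suc n) \<le> n" "Suc n \<in> \<tau> ` {1..n}"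
  defines "r \<equiv> source_rank n \<tau>"
  shows "r \<le> h" "incr n (del n (fall_unshift n r) \<tau>)"
proof -
  define s where "s = inv_into {1..n} \<tau> (Suc n)"
  have s: "s \<in> {1..n}" "\<tau> s = Suc n"
    unfolding s_def using assms(4) by (rule inv_into_into, rule f_inv_into_f)
  have r: "r = card {i\<in>{1..<s}. Suc n < \<tau> i}"
    unfolding r_def source_rank_def s_def ..
  have inj: "inj_on \<tau> {1..Suc n}" and ran: "\<tau> ` {1..Suc n} \<subseteq> {1..Suc n + h}"
    using st unfolding partial_perm_def by blast+
  have val: "\<tau> i = Suc (Suc n) + card {j\<in>{1..<i}. Suc n < \<tau> j}" if "i \<in> {1..n}" "Suc n < \<tau> i" for i
    using card_open_less[OF st inc, of i] that by auto
  have below: "\<tau> i < Suc (Suc (n + r))" if "i \<in> {1..<s}" "Suc n < \<tau> i" for i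
  proof -
    have "card {j\<in>{1..<i}. Suc n < \<tau> j} < r"
      unfolding r using that by (intro psubset_card_mono) auto
    then show ?thesis
      using val[of i] that s(1) by simp
  qed
  have above: "Suc (Suc (n + r)) \<le> \<tau> i" if "i \<in> {s<..n}" "Suc n < \<tau> i" for i
  proof -
    have "r \<le> card {j\<in>{1..<i}. Suc n < \<tau> j}"
      unfolding r using that by (intro card_mono) auto
    then show ?thesis
      using val[of i] that s(1) by simp
  qed
  have "card {i\<in>{1..<s}. Suc n < \<tau> i} \<le> card {Suc (Suc n)..Suc n + h}"
  proof (rule card_inj_on_le)
    show "inj_on \<tau> {i\<in>{1..<s}. Suc n < \<tau> i}"
      by (rule inj_on_subset[OF inj]) (use s(1) in auto)
    show "\<tau> ` {i\<in>{1..<s}. Suc n < \<tau> i} \<subseteq> {Suc (Suc n)..Suc n + h}"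
    proof (rule image_subsetI)
      fix i assume i: "i \<in> {i\<in>{1..<s}. Suc n < \<tau> i}"
      then have "\<tau> i \<in> \<tau> ` {1..Suc n}"
        using s(1) by (intro imageI) auto
      then show "\<tau> i \<in> {Suc (Suc n)..Suc n + h}"
        using subsetD[OF ran] i by fastforce
    qed
  qed simp
  then show "r \<le> h"
    unfolding r by simp
  show "incr n (del n (fall_unshift n r) \<tau>)"
    unfolding incr_def
  proof (intro allI impI)
    fix i j
    assume ij: "1 \<le> i" "i < j" "j \<le> n" "n < del n (fall_unshift n r) \<tau> i" "n < del n (fall_unshift n r) \<tau> j"
    then have gt: "n < \<tau> i" "n < \<tau> j"
      by (auto simp: del_def fall_unshift_def split: if_splits)
    have ne: "\<tau> i \<noteq> \<tau> j"
      using inj_onD[OF inj, of i j] ij(1,2,3) by auto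
    have eq: "l = s" if "\<tau> l = Suc n" "l \<in> {1..n}" for l
      using inj_onD[OF inj, of l s] s that by simp
    consider "\<tau> i = Suc n" "\<tau> j > Suc n" | "\<tau> j = Suc n" "\<tau> i > Suc n" | "\<tau> i > Suc n" "\<tau> j > Suc n"
      using gt ne by linarith
    then have "fall_unshift n r (\<tau> i) < fall_unshift n r (\<tau> j)"
    proof cases
      case 1
      then have "i = s"
        using eq[of i] ij by simp
      then show ?thesis
        using above[of j] 1 ij by (simp add: fall_unshift_def)
    next
      case 2
      then have "j = s"
        using eq[of j] ij by simp
      then show ?thesis
        using below[of i] 2 ij by (simp add: fall_unshift_def)
    next
      case 3
      then have "\<tau> i < \<tau> j"
        using incrD[OF inc, of i j] ij by simp
      then show ?thesis
        using 3 by (auto simp: fall_unshift_def)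
    qed
    then show "del n (fall_unshift n r) \<tau> i < del n (fall_unshift n r) \<tau> j"
      using ij by (simp add: del_def)
  qed
qed

text \<open>Compared with \<open>sum_partial_perms_Suc\<close>, the \<open>h\<close> choices of a
  rise to height \<open>h\<close> have moved to the falls from height \<open>h\<close>.\<close>

lemma sum_incr_partial_perms_Suc:
  "sum g {\<tau>. partial_perm (Suc n) h \<tau> \<and> incr (Suc n) \<tau>} =
    (if h = 0 then 0 else \<Sum>\<tau> | partial_perm n (h - 1) \<tau> \<and> incr n \<tau>. g (rise n (h - 1) \<tau>)) +
    (\<Sum>\<tau> | partial_perm n h \<tau> \<and> incr n \<tau>. \<Sum>m\<in>missing n \<tau>. g (level n h m \<tau>)) +
    (\<Sum>\<tau> | partial_perm n (Suc h) \<tau> \<and> incr n \<tau>. \<Sum>(r, m)\<in>{..h} \<times> missing n \<tau>. g (fall n r m \<tau>) :: 'a::comm_monoid_add)"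
proof -
  let ?S = "{\<tau>. partial_perm (Suc n) h \<tau> \<and> incr (Suc n) \<tau>}"
  have fin: "finite {\<tau>. partial_perm n h \<tau> \<and> incr n \<tau>}" for h
    by (rule finite_subset[OF _ finite_partial_perms[of n h]]) auto
  have "sum g {\<tau>\<in>?S. Suc n < \<tau> (Suc n)} =
    (if h = 0 then 0 else \<Sum>\<tau> | partial_perm n (h - 1) \<tau> \<and> incr n \<tau>. g (rise n (h - 1) \<tau>))"
  proof (cases h)
    case 0
    have "{\<tau>\<in>?S. Suc n < \<tau> (Suc n)} = {}"
      using partial_perm_Suc_dest(6)[of n 0] 0 by fastforce
    then have "sum g {\<tau>\<in>?S. Suc n < \<tau> (Suc n)} = 0"
      by (simp only: sum.empty)
    then show ?thesis using 0 by simp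
  next
    case (Suc h')
    have "sum g {\<tau>\<in>?S. Suc n < \<tau> (Suc n)} =
        (\<Sum>\<tau> | partial_perm n h' \<tau> \<and> incr n \<tau>. \<Sum>r\<in>{h'}. g (rise n r \<tau>))"
    proof (rule sum_reindex_Sigma)
      fix \<tau> r assume *: "\<tau> \<in> {\<tau>. partial_perm n h' \<tau> \<and> incr n \<tau>}" "r \<in> {h'}"
      then show "rise n r \<tau> \<in> {\<tau>\<in>?S. Suc n < \<tau> (Suc n)} \<and>
          del n (up_unshift n (rise n r \<tau> (Suc n) - Suc (Suc n))) (rise n r \<tau>) = \<tau> \<and>
          rise n r \<tau> (Suc n) - Suc (Suc n) = r"
        using rise_bij[of \<tau> n h' r] incr_rise[of n h' \<tau> r] Suc by simp
    next
      fix \<tau> assume *: "\<tau> \<in> {\<tau>\<in>?S. Suc n < \<tau> (Suc n)}"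
      define r where "r = \<tau> (Suc n) - Suc (Suc n)"
      define \<rho> where "\<rho> = del n (up_unshift n r) \<tau>"
      have "\<rho> \<in> Collect (partial_perm n h') \<and> r \<in> {..h'} \<and> rise n r \<rho> = \<tau>"
        unfolding r_def \<rho>_def using * Suc by (intro rise_bij') simp
      then have \<rho>: "partial_perm n h' \<rho>" "r \<le> h'" "rise n r \<rho> = \<tau>"
        by simp_all
      moreover have "r = h' \<and> incr n \<rho>"
        using incr_rise[OF \<rho>(1,2)] * unfolding \<rho>(3) by simp
      ultimately show "del n (up_unshift n r) \<tau> \<in> {\<tau>. partial_perm n h' \<tau> \<and> incr n \<tau>} \<and> r \<in> {h'} \<and>
          rise n r (del n (up_unshift n r) \<tau>) = \<tau>"
        unfolding \<rho>_def[symmetric] by simp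
    qed (simp_all add: fin)
    then show ?thesis using Suc by simp
  qed
  moreover have "sum g {\<tau>\<in>?S. \<tau> (Suc n) \<le> n \<and> Suc n \<notin> \<tau> ` {1..n}} =
      (\<Sum>\<tau> | partial_perm n h \<tau> \<and> incr n \<tau>. \<Sum>m\<in>missing n \<tau>. g (level n h m \<tau>))"
  proof (rule sum_reindex_Sigma)
    fix \<tau> m assume *: "\<tau> \<in> {\<tau>. partial_perm n h \<tau> \<and> incr n \<tau>}" "m \<in> missing n \<tau>"
    then have "m \<le> n"
      by (simp add: missing_def)
    then show "level n h m \<tau> \<in> {\<tau>\<in>?S. \<tau> (Suc n) \<le> n \<and> Suc n \<notin> \<tau> ` {1..n}} \<and>
        del n (up_unshift n h) (level n h m \<tau>) = \<tau> \<and> level n h m \<tau> (Suc n) = m"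
      using level_bij[of \<tau> n h m] incr_level[of m n h \<tau>] * by simp
  next
    fix \<tau> assume *: "\<tau> \<in> {\<tau>\<in>?S. \<tau> (Suc n) \<le> n \<and> Suc n \<notin> \<tau> ` {1..n}}"
    then show "del n (up_unshift n h) \<tau> \<in> {\<tau>. partial_perm n h \<tau> \<and> incr n \<tau>} \<and>
        \<tau> (Suc n) \<in> missing n (del n (up_unshift n h) \<tau>) \<and>
        level n h (\<tau> (Suc n)) (del n (up_unshift n h) \<tau>) = \<tau>"
      using level_bij'[of \<tau> n h] incr_level[of "\<tau> (Suc n)" n h "del n (up_unshift n h) \<tau>"] by simp
  qed (simp_all add: fin)
  moreover have "sum g {\<tau>\<in>?S. \<tau> (Suc n) \<le> n \<and> Suc n \<in> \<tau> ` {1..n}} =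
      (\<Sum>\<tau> | partial_perm n (Suc h) \<tau> \<and> incr n \<tau>. \<Sum>c\<in>{..h} \<times> missing n \<tau>. g (case c of (r, m) \<Rightarrow> fall n r m \<tau>))"
  proof (rule sum_reindex_Sigma)
    fix \<tau> c assume *: "\<tau> \<in> {\<tau>. partial_perm n (Suc h) \<tau> \<and> incr n \<tau>}" "c \<in> {..h} \<times> missing n \<tau>"
    obtain r m where c: "c = (r, m)" by (cases c)
    have "m \<le> n"
      using * c by (simp add: missing_def)
    then show "(case c of (r, m) \<Rightarrow> fall n r m \<tau>) \<in> {\<tau>\<in>?S. \<tau> (Suc n) \<le> n \<and> Suc n \<in> \<tau> ` {1..n}} \<and>
        del n (fall_unshift n (source_rank n (case c of (r, m) \<Rightarrow> fall n r m \<tau>)))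
          (case c of (r, m) \<Rightarrow> fall n r m \<tau>) = \<tau> \<and>
        (source_rank n (case c of (r, m) \<Rightarrow> fall n r m \<tau>), (case c of (r, m) \<Rightarrow> fall n r m \<tau>) (Suc n)) = c"
      using fall_bij[of \<tau> n h m r] source_rank_fall[of n h \<tau> m r] incr_fall[of n \<tau> m r] * c by simp
  next
    fix \<tau> assume *: "\<tau> \<in> {\<tau>\<in>?S. \<tau> (Suc n) \<le> n \<and> Suc n \<in> \<tau> ` {1..n}}"
    then show "del n (fall_unshift n (source_rank n \<tau>)) \<tau> \<in> {\<tau>. partial_perm n (Suc h) \<tau> \<and> incr n \<tau>} \<and>
        (source_rank n \<tau>, \<tau> (Suc n)) \<in> {..h} \<times> missing n (del n (fall_unshift n (source_rank n \<tau>)) \<tau>) \<and>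
        (case (source_rank n \<tau>, \<tau> (Suc n)) of (r, m) \<Rightarrow>
          fall n r m (del n (fall_unshift n (source_rank n \<tau>)) \<tau>)) = \<tau>"
      using fall_bij'[of \<tau> n h "source_rank n \<tau>"] source_rank_properties[of n h \<tau>] by simp
  qed (simp_all add: fin)
  ultimately show ?thesis
    by (subst sum_partial_perms_cases[of ?S n h]) (auto simp: case_prod_unfold)
qed

section \<open>The statistics of partial permutations\<close>

text \<open>Whether \<open>p\<close> counts for one of the following statistics is already decided by the trace on
  \<open>{1..p}\<close>.  For permutations they count cycles (by their maxima), ear and pex.\<close>

definition cycle_max :: "nat \<Rightarrow> (nat \<Rightarrow> nat) \<Rightarrow> bool" where
  "cycle_max p \<tau> \<longleftrightarrow> (\<forall>k. (\<tau> ^^ k) p \<le> p)"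

definition ear_at :: "nat \<Rightarrow> (nat \<Rightarrow> nat) \<Rightarrow> bool" where
  "ear_at p \<tau> \<longleftrightarrow> \<tau> p < p \<and> p \<in> \<tau> ` {1..<p} \<and> {1..<\<tau> p} \<subseteq> \<tau> ` {1..<p}"

definition pex_at :: "nat \<Rightarrow> (nat \<Rightarrow> nat) \<Rightarrow> bool" where
  "pex_at p \<tau> \<longleftrightarrow> \<tau> p > p \<and> (\<forall>j\<in>{1..<p}. \<tau> j \<notin> {p..\<tau> p})"

definition stat :: "(nat \<Rightarrow> (nat \<Rightarrow> nat) \<Rightarrow> bool) \<Rightarrow> nat \<Rightarrow> (nat \<Rightarrow> nat) \<Rightarrow> nat" where
  "stat P n \<tau> = card {p\<in>{1..n}. P p \<tau>}"

lemma stat_ins: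
  assumes "\<And>p. p \<in> {1..n} \<Longrightarrow> P p \<tau>' = P p \<tau>"
  shows "stat P (Suc n) \<tau>' = stat P n \<tau> + (if P (Suc n) \<tau>' then 1 else 0)"
proof -
  have "{p\<in>{1..Suc n}. P p \<tau>'} = {p\<in>{1..n}. P p \<tau>} \<union> (if P (Suc n) \<tau>' then {Suc n} else {})"
    using assms by (auto simp: le_Suc_eq)
  then show ?thesis
    by (simp add: stat_def card_Un_disjoint)
qed

text \<open>The common property of all renumberings used: comparisons with a point of
  \<open>{1..n}\<close> are unaffected, although placeholders may change their order.\<close>

definition shift_above :: "nat \<Rightarrow> (nat \<Rightarrow> nat) \<Rightarrow> bool" where
  "shift_above n \<phi> \<longleftrightarrow> (\<forall>v\<le>n. \<phi> v = v) \<and> (\<forall>v>n. \<phi> v > n)"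

lemma shift_above_up [simp]: "shift_above n (up_shift n r)"
  by (simp add: shift_above_def up_shift_bounds)

lemma shift_above_fall [simp]: "shift_above n (fall_shift n r)"
  by (simp add: shift_above_def fall_shift_bounds)

lemma shift_above_iff:
  assumes "shift_above n \<phi>" "i \<le> n"
  shows "\<phi> v = i \<longleftrightarrow> v = i" "\<phi> v < i \<longleftrightarrow> v < i" "\<phi> v \<le> i \<longleftrightarrow> v \<le> i" "i < \<phi> v \<longleftrightarrow> i < v" "i \<le> \<phi> v \<longleftrightarrow> i \<le> v"
proof -
  consider "v \<le> n" "\<phi> v = v" | "v > n" "\<phi> v > n"
    using assms(1) unfolding shift_above_def by (metis not_le)
  then show "\<phi> v = i \<longleftrightarrow> v = i" "\<phi> v < i \<longleftrightarrow> v < i" "\<phi> v \<le> i \<longleftrightarrow> v \<le> i" "i < \<phi> v \<longleftrightarrow> i < v" "i \<le> \<phi> v \<longleftrightarrow> i \<le> v"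
    using assms(2) by (cases; simp)+
qed

lemma shift_above_eq: "shift_above n \<phi> \<Longrightarrow> v \<le> n \<Longrightarrow> \<phi> v = v"
  by (simp add: shift_above_def)

lemma shift_above_image:
  assumes "shift_above n \<phi>" "i \<le> n"
  shows "i \<in> \<phi> ` A \<longleftrightarrow> i \<in> A"
  unfolding image_iff using shift_above_iff(1)[OF assms] by metis

lemma exc_at_ins:
  assumes "shift_above n \<phi>" "p \<in> {1..n}"
  shows "p < ins n \<phi> x \<tau> p \<longleftrightarrow> p < \<tau> p"
  using assms by (simp add: ins_le shift_above_iff)

text \<open>Only values up to \<open>p\<close> enter, and they are never renumbered.\<close>

lemma ear_at_ins:
  assumes "shift_above n \<phi>" "p \<in> {1..n}"
  shows "ear_at p (ins n \<phi> x \<tau>) \<longleftrightarrow> ear_at p \<tau>"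
proof -
  have im: "v \<in> ins n \<phi> x \<tau> ` {1..<p} \<longleftrightarrow> v \<in> \<tau> ` {1..<p}" if "v \<le> n" for v
    using assms(2) shift_above_image[OF assms(1) that] by (subst ins_image_less) auto
  show ?thesis
  proof (cases "\<tau> p < p")
    case True
    then have "ins n \<phi> x \<tau> p = \<tau> p"
      using assms by (simp add: ins_le shift_above_eq)
    moreover have "{1..<\<tau> p} \<subseteq> ins n \<phi> x \<tau> ` {1..<p} \<longleftrightarrow> {1..<\<tau> p} \<subseteq> \<tau> ` {1..<p}"
      unfolding subset_iff using im True assms(2) by auto
    ultimately show ?thesis
      using im[of p] assms(2) by (simp add: ear_at_def)
  next
    case False
    then show ?thesis
      using assms by (simp add: ear_at_def ins_le shift_above_iff)
  qed
qed

text \<open>Images of two open points are compared here, so \<open>\<phi>\<close> has to preserve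
  their order. \<open>fall_shift n r\<close> does this only for \<open>r = 0\<close>, which ties pex
  to the scheme with ordered images.\<close>

lemma pex_at_ins:
  assumes "shift_above n \<phi>" "strict_mono \<phi>" "p \<in> {1..n}"
  shows "pex_at p (ins n \<phi> x \<tau>) \<longleftrightarrow> pex_at p \<tau>"
proof -
  have "ins n \<phi> x \<tau> j \<in> {p..ins n \<phi> x \<tau> p} \<longleftrightarrow> \<tau> j \<in> {p..\<tau> p}" if "j \<in> {1..<p}" for j
    using that assms by (simp add: ins_le shift_above_iff strict_mono_less_eq)
  then show ?thesis
    using exc_at_ins[OF assms(1,3)] by (simp add: pex_at_def)
qed

lemma ins_below:
  assumes "partial_perm n h \<tau>" "shift_above n \<phi>" "i \<le> n"
  shows "ins n \<phi> x \<tau> i = \<phi> (\<tau> i)"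
proof (cases "i = 0")
  case True
  then have "\<tau> i = 0"
    using assms(1) unfolding partial_perm_def by simp
  then show ?thesis
    using True assms(2) by (simp add: ins_def shift_above_def)
next
  case False
  then show ?thesis using assms(3) by (simp add: ins_le)
qed

text \<open>As long as the path runs through proper values \<open>\<phi>\<close> is invisible; it
  can affect only the end point.\<close>

lemma funpow_ins:
  assumes "partial_perm n h \<tau>" "shift_above n \<phi>" "m \<le> n" "\<And>i. i < k \<Longrightarrow> (\<tau> ^^ i) m \<le> n"
  shows "(ins n \<phi> x \<tau> ^^ k) m = \<phi> ((\<tau> ^^ k) m)"
  using assms(4)
proof (induction k)
  case 0
  then show ?case using assms(2,3) by (simp add: shift_above_eq)
next
  case (Suc k)
  then have "(\<tau> ^^ k) m \<le> n" "(ins n \<phi> x \<tau> ^^ k) m = \<phi> ((\<tau> ^^ k) m)"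
    by simp_all
  then show ?case
    using ins_below[OF assms(1,2)] assms(2) by (simp add: shift_above_eq)
qed

lemma cycle_max_ins:
  assumes "partial_perm n h \<tau>" "shift_above n \<phi>" "p \<in> {1..n}"
  shows "cycle_max p (ins n \<phi> x \<tau>) \<longleftrightarrow> cycle_max p \<tau>"
proof
  assume *: "cycle_max p \<tau>"
  have "(ins n \<phi> x \<tau> ^^ k) p = \<phi> ((\<tau> ^^ k) p)" for k
    using assms * by (intro funpow_ins) (auto simp: cycle_max_def intro: order_trans)
  then show "cycle_max p (ins n \<phi> x \<tau>)"
    using * assms(2,3) by (simp add: cycle_max_def shift_above_iff)
next
  assume *: "cycle_max p (ins n \<phi> x \<tau>)"
  have "(\<tau> ^^ k) p \<le> p" for k
  \<comment> \<open>Strong induction, since \<open>funpow_ins\<close> needs all earlier iterates of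
    \<open>\<tau>\<close> to be at most \<open>n\<close>.\<close>
  proof (induction k rule: less_induct)
    case (less k)
    then have "(ins n \<phi> x \<tau> ^^ k) p = \<phi> ((\<tau> ^^ k) p)"
      using assms(3) by (intro funpow_ins[OF assms(1,2)]) (auto intro: order_trans)
    then show ?case
      using * assms(2,3) shift_above_iff(3)[OF assms(2), of p] by (simp add: cycle_max_def) metis
  qed
  then show "cycle_max p \<tau>"
    by (simp add: cycle_max_def)
qed

section \<open>Paths from missing values to placeholders\<close>

lemma funpow_cancel:
  assumes "inj_on f A" "\<And>i. i < a \<Longrightarrow> (f ^^ i) x \<in> A" "\<And>i. i < b \<Longrightarrow> (f ^^ i) y \<in> A"
    "a \<le> b" "(f ^^ a) x = (f ^^ b) y"
  shows "x = (f ^^ (b - a)) y"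
  using assms(2-)
proof (induction a arbitrary: b)
  case 0
  then show ?case by simp
next
  case (Suc a)
  obtain b' where b: "b = Suc b'"
    using Suc.prems(3) by (cases b) simp_all
  \<comment> \<open>The last step on both sides is undone; injectivity is available because both
    points it starts from lie in \<open>A\<close>.\<close>
  have "(f ^^ a) x = (f ^^ b') y"
    using Suc.prems(4) Suc.prems(1)[of a] Suc.prems(2)[of b'] b
    by (simp add: inj_on_eq_iff[OF assms(1)])
  moreover have "(f ^^ i) x \<in> A" if "i < a" for i
    using Suc.prems(1)[of i] that by simp
  moreover have "(f ^^ i) y \<in> A" if "i < b'" for i
    using Suc.prems(2)[of i] that b by simp
  ultimately have "x = (f ^^ (b' - a)) y"
    using Suc.prems(3) b by (intro Suc.IH) simp_all
  then show ?case using b by simp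
qed

text \<open>The path from a missing value must leave \<open>{1..n}\<close> because \<open>\<tau>\<close> is injective.  This matches the
  missing values with the placeholders; joining the end of such a path to its start closes a cycle.\<close>

definition exit_time :: "nat \<Rightarrow> (nat \<Rightarrow> nat) \<Rightarrow> nat \<Rightarrow> nat" where
  "exit_time n \<tau> m = (LEAST k. n < (\<tau> ^^ k) m)"

definition exit_value :: "nat \<Rightarrow> (nat \<Rightarrow> nat) \<Rightarrow> nat \<Rightarrow> nat" where
  "exit_value n \<tau> m = (\<tau> ^^ exit_time n \<tau> m) m"

lemma missing_not_funpow:
  assumes "m \<in> missing n \<tau>" "m = (\<tau> ^^ k) m'" "\<And>i. i < k \<Longrightarrow> (\<tau> ^^ i) m' \<in> {1..n}"
  shows "k = 0"
proof (rule ccontr)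
  assume "k \<noteq> 0"
  then obtain k' where "k = Suc k'"
    by (cases k) auto
  then have "m = \<tau> ((\<tau> ^^ k') m')" "(\<tau> ^^ k') m' \<in> {1..n}"
    using assms(2,3) by simp_all
  then have "m \<in> \<tau> ` {1..n}"
    by (rule image_eqI)
  then show False
    using assms(1) by (simp add: missing_def)
qed

text \<open>A path that stays in \<open>{1..n}\<close> repeats a value; cancelling back to its start
  would give \<open>m\<close> a preimage.\<close>

lemma exit_exists:
  assumes "partial_perm n h \<tau>" "m \<in> missing n \<tau>"
  shows "\<exists>k. n < (\<tau> ^^ k) m"
proof (rule ccontr)
  assume *: "\<nexists>k. n < (\<tau> ^^ k) m"
  have mem: "(\<tau> ^^ k) m \<in> {1..n}" for k
  proof (induction k)
    case 0
    then show ?case using assms(2) by (simp add: missing_def)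
  next
    case (Suc k)
    then have "\<tau> ((\<tau> ^^ k) m) \<in> {1..n + h}"
      by (rule partial_perm_bound[OF assms(1)])
    then show ?case
      using * by (simp add: not_less) (metis funpow.simps(2) comp_apply)
  qed
  have "\<not> inj (\<lambda>k. (\<tau> ^^ k) m)"
  proof
    assume "inj (\<lambda>k. (\<tau> ^^ k) m)"
    then have "infinite (range (\<lambda>k. (\<tau> ^^ k) m))"
      by (simp add: finite_image_iff)
    moreover have "range (\<lambda>k. (\<tau> ^^ k) m) \<subseteq> {1..n}"
      using mem by blast
    ultimately show False
      using finite_subset by blast
  qed
  then obtain a b where ab: "a < b" "(\<tau> ^^ a) m = (\<tau> ^^ b) m"
    unfolding inj_def by (metis linorder_neqE_nat)
  then have "m = (\<tau> ^^ (b - a)) m"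
    by (intro funpow_cancel[OF partial_perm_inj[OF assms(1)]]) (use mem in auto)
  then have "b - a = 0"
    by (rule missing_not_funpow[OF assms(2)]) (rule mem)
  with ab show False by simp
qed

lemma exit_value_gt:
  assumes "partial_perm n h \<tau>" "m \<in> missing n \<tau>"
  shows "n < exit_value n \<tau> m"
  unfolding exit_value_def exit_time_def using exit_exists[OF assms] by (rule LeastI_ex)

lemma before_exit:
  assumes "partial_perm n h \<tau>" "m \<in> missing n \<tau>" "i < exit_time n \<tau> m"
  shows "(\<tau> ^^ i) m \<in> {1..n}"
  using assms(3)
proof (induction i)
  case 0
  then show ?case using assms(2) by (simp add: missing_def)
next
  case (Suc i)
  then have "\<tau> ((\<tau> ^^ i) m) \<in> {1..n + h}"
    by (intro partial_perm_bound[OF assms(1)]) simp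
  moreover have "\<not> n < (\<tau> ^^ Suc i) m"
    using Suc.prems unfolding exit_time_def by (rule not_less_Least)
  ultimately show ?case by simp
qed

text \<open>Two paths with the same exit are traced back together until the shorter one reaches its
  start; this start lies on the other path, where a missing value can only be the first point.
  Surjectivity follows by counting.\<close>

lemma exit_value_bij:
  assumes "partial_perm n h \<tau>"
  shows "bij_betw (exit_value n \<tau>) (missing n \<tau>) {Suc n..n + h}"
proof -
  have inj: "inj_on (exit_value n \<tau>) (missing n \<tau>)"
  proof (rule linorder_inj_onI')
    have "m = m'" if m: "m \<in> missing n \<tau>" "m' \<in> missing n \<tau>" "exit_value n \<tau> m = exit_value n \<tau> m'"
      and le: "exit_time n \<tau> m \<le> exit_time n \<tau> m'" for m m'
    proof -
      let ?d = "exit_time n \<tau> m' - exit_time n \<tau> m"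
      have *: "m = (\<tau> ^^ ?d) m'"
        using m before_exit[OF assms] le
        by (intro funpow_cancel[OF partial_perm_inj[OF assms]]) (auto simp: exit_value_def)
      moreover have "?d = 0"
        by (rule missing_not_funpow[OF m(1) *]) (use before_exit[OF assms m(2)] in auto)
      ultimately show ?thesis by simp
    qed
    then show "exit_value n \<tau> i \<noteq> exit_value n \<tau> j"
      if "i \<in> missing n \<tau>" "j \<in> missing n \<tau>" "i < j" for i j
      using that by (metis less_irrefl linear)
  qed
  have "exit_value n \<tau> ` missing n \<tau> \<subseteq> {Suc n..n + h}"
  proof (rule image_subsetI)
    fix m assume m: "m \<in> missing n \<tau>"
    have "exit_time n \<tau> m \<noteq> 0"
    proof
      assume "exit_time n \<tau> m = 0"
      then have "exit_value n \<tau> m = m"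
        by (simp add: exit_value_def)
      then show False
        using exit_value_gt[OF assms m] m by (simp add: missing_def)
    qed
    then obtain k where k: "exit_time n \<tau> m = Suc k"
      by (cases "exit_time n \<tau> m") auto
    then have "(\<tau> ^^ k) m \<in> {1..n}"
      by (intro before_exit[OF assms m]) simp
    then have "exit_value n \<tau> m \<in> {1..n + h}"
      using partial_perm_bound[OF assms] by (simp add: exit_value_def k)
    then show "exit_value n \<tau> m \<in> {Suc n..n + h}"
      using exit_value_gt[OF assms m] by simp
  qed
  moreover have "card (exit_value n \<tau> ` missing n \<tau>) = card {Suc n..n + h}"
    using card_image[OF inj] card_missing[OF assms] by simp
  ultimately have "exit_value n \<tau> ` missing n \<tau> = {Suc n..n + h}"
    by (intro card_subset_eq) auto
  with inj show ?thesis
    by (rule bij_betw_imageI)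
qed

text \<open>From \<open>n + 1\<close> one moves to \<open>m\<close>, then along the old path of
  \<open>m\<close> to its renumbered exit value. This value exceeds \<open>n\<close>, so it either
  closes the cycle at \<open>n + 1\<close> or exceeds \<open>n + 1\<close>.\<close>

lemma cycle_max_Suc_ins:
  assumes st: "partial_perm n h \<tau>" and \<phi>: "shift_above n \<phi>" and m: "m \<in> missing n \<tau>"
  shows "cycle_max (Suc n) (ins n \<phi> m \<tau>) \<longleftrightarrow> \<phi> (exit_value n \<tau> m) = Suc n"
proof -
  let ?\<tau> = "ins n \<phi> m \<tau>"
  let ?K = "exit_time n \<tau> m"
  have "m \<le> n"
    using m by (simp add: missing_def)
  have before: "(\<tau> ^^ i) m \<le> n" if "i < ?K" for i
    using before_exit[OF st m that] by simp
  have pow: "(?\<tau> ^^ k) m = \<phi> ((\<tau> ^^ k) m)" if "k \<le> ?K" for k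
    using that before by (intro funpow_ins[OF st \<phi> \<open>m \<le> n\<close>]) auto
  have "?K \<noteq> 0"
  proof
    assume "?K = 0"
    then have "exit_value n \<tau> m = m"
      by (simp add: exit_value_def)
    then show False
      using exit_value_gt[OF st m] \<open>m \<le> n\<close> by simp
  qed
  have 1: "(?\<tau> ^^ Suc ?K) (Suc n) = \<phi> (exit_value n \<tau> m)"
    using pow[of ?K] by (simp only: funpow_Suc_right comp_apply ins_Suc exit_value_def order_refl)
  have gt: "\<phi> (exit_value n \<tau> m) > n"
    using \<phi> exit_value_gt[OF st m] by (simp add: shift_above_def)
  show ?thesis
  proof
    assume "cycle_max (Suc n) ?\<tau>"
    then have "(?\<tau> ^^ Suc ?K) (Suc n) \<le> Suc n"
      unfolding cycle_max_def by blast
    then show "\<phi> (exit_value n \<tau> m) = Suc n"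
      using 1 gt by simp
  next
    assume *: "\<phi> (exit_value n \<tau> m) = Suc n"
    \<comment> \<open>The whole cycle of \<open>n + 1\<close>; it is invariant and bounded by
      \<open>n + 1\<close>.\<close>
    let ?C = "insert (Suc n) ((\<lambda>k. (\<tau> ^^ k) m) ` {..<?K})"
    have step: "?\<tau> c \<in> ?C" if "c \<in> ?C" for c
    proof (cases "c = Suc n")
      case True
      have "m \<in> (\<lambda>k. (\<tau> ^^ k) m) ` {..<?K}"
        by (rule image_eqI[of _ _ 0]) (use \<open>?K \<noteq> 0\<close> in auto)
      then show ?thesis
        using True by simp
    next
      case False
      then obtain k where k: "k < ?K" "c = (\<tau> ^^ k) m"
        using \<open>c \<in> ?C\<close> by auto
      have c: "?\<tau> c = \<phi> ((\<tau> ^^ Suc k) m)"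
        unfolding k(2) using ins_below[OF st \<phi> before[OF k(1)]] by simp
      show ?thesis
      proof (cases "Suc k = ?K")
        case True
        then show ?thesis
          using c * by (simp add: exit_value_def)
      next
        case False
        then have "Suc k < ?K"
          using k(1) by simp
        then show ?thesis
          using c before[of "Suc k"] \<phi> by (simp only: shift_above_eq) blast
      qed
    qed
    have "(?\<tau> ^^ k) (Suc n) \<in> ?C" for k
      by (induction k) (use step in auto)
    moreover have "c \<le> Suc n" if "c \<in> ?C" for c
      using that before by (auto intro: le_SucI)
    ultimately show "cycle_max (Suc n) ?\<tau>"
      unfolding cycle_max_def by blast
  qed
qed

text \<open>The source of every factor of the form \<open>c + h - 1\<close>: among \<open>h\<close>
  choices exactly one is distinguished and contributes \<open>c\<close>.\<close>

lemma sum_if_unique: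
  fixes c :: "'a::comm_ring_1"
  assumes "finite A" "x \<in> A" "\<And>z. z \<in> A \<Longrightarrow> P z \<longleftrightarrow> z = x"
  shows "(\<Sum>z\<in>A. if P z then c else 1) = c + of_nat (card A) - 1"
proof -
  have "(\<Sum>z\<in>A. if P z then c else 1) = c + (\<Sum>z\<in>A - {x}. if P z then c else 1)"
    using assms by (simp add: sum.remove[OF assms(1,2)])
  also have "(\<Sum>z\<in>A - {x}. if P z then c else 1) = (\<Sum>z\<in>A - {x}. 1)"
    by (rule sum.cong) (use assms(3) in auto)
  also have "\<dots> = of_nat (card A) - 1"
    using card_gt_0_iff[of A] assms(1,2) by (auto simp: card_Diff_singleton of_nat_diff)
  finally show ?thesis by (simp add: algebra_simps)
qed

text \<open>For \<open>r > 0\<close> the old placeholder \<open>n + 1\<close> becomes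
  \<open>n + 2\<close> and lies between the new point and its image. For \<open>r = 0\<close> the
  new image is itself the smallest placeholder.\<close>

lemma pex_at_rise:
  assumes "partial_perm n h \<tau>" "r \<le> h"
  shows "pex_at (Suc n) (rise n r \<tau>) \<longleftrightarrow> r = 0"
proof
  assume *: "pex_at (Suc n) (rise n r \<tau>)"
  show "r = 0"
  proof (rule ccontr)
    assume "r \<noteq> 0"
    then have "Suc n \<in> {Suc n..n + h}"
      using assms(2) by simp
    then obtain i where i: "i \<in> {1..n}" "\<tau> i = Suc n"
      using partial_perm_ex[OF assms(1)] by blast
    then have "rise n r \<tau> i = Suc (Suc n)"
      using \<open>r \<noteq> 0\<close> by (simp add: ins_le up_shift_def)
    moreover have "rise n r \<tau> i \<notin> {Suc n..rise n r \<tau> (Suc n)}"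
      using * i(1) unfolding pex_at_def by (metis atLeastAtMost_iff atLeastLessThan_iff less_Suc_eq_le)
    ultimately show False by simp
  qed
next
  assume "r = 0"
  have "rise n 0 \<tau> j \<notin> {Suc n..Suc (Suc n)}" if "j \<in> {1..n}" for j
    using that up_shift_neq[of n 0 "\<tau> j"] by (auto simp: ins_le le_Suc_eq up_shift_bounds)
  then show "pex_at (Suc n) (rise n r \<tau>)"
    using \<open>r = 0\<close> by (simp add: pex_at_def atLeastLessThanSuc_atLeastAtMost)
qed

text \<open>All values below \<open>m\<close> are taken exactly when \<open>m\<close> is the least
  missing one; \<open>Suc_in_fall\<close> supplies the peak condition.\<close>

lemma ear_at_fall:
  assumes "partial_perm n (Suc h) \<tau>" "r \<le> h" "m \<in> missing n \<tau>"
  shows "ear_at (Suc n) (fall n r m \<tau>) \<longleftrightarrow> m = Min (missing n \<tau>)"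
proof -
  have m: "1 \<le> m" "m \<le> n"
    using assms(3) by (auto simp: missing_def)
  have "{1..<m} \<subseteq> fall n r m \<tau> ` {1..n} \<longleftrightarrow> {1..<m} \<inter> missing n \<tau> = {}"
  proof -
    have "u \<in> fall n r m \<tau> ` {1..n} \<longleftrightarrow> u \<notin> missing n \<tau>" if "u \<in> {1..<m}" for u
      unfolding ins_image_le using that m shift_above_image[OF shift_above_fall, of u n r]
      by (auto simp: missing_def)
    then show ?thesis by blast
  qed
  also have "\<dots> \<longleftrightarrow> m = Min (missing n \<tau>)"
  proof
    assume *: "{1..<m} \<inter> missing n \<tau> = {}"
    have "m \<le> u" if "u \<in> missing n \<tau>" for u
      using that * by (cases "u < m") (auto simp: missing_def)
    then show "m = Min (missing n \<tau>)"
      using assms(3) by (intro Min_eqI[symmetric]) auto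
  next
    assume *: "m = Min (missing n \<tau>)"
    have "m \<le> u" if "u \<in> missing n \<tau>" for u
      unfolding * using that by simp
    then show "{1..<m} \<inter> missing n \<tau> = {}"
      by fastforce
  qed
  finally show ?thesis
    using m Suc_in_fall[OF assms(1,2), of m]
    by (simp add: ear_at_def atLeastLessThanSuc_atLeastAtMost)
qed

text \<open>The cycle closes when the path of \<open>m\<close> ends at the placeholder being
  replaced. Since \<open>exit_value\<close> is a bijection, this singles out one \<open>m\<close>
  for fixed \<open>r\<close> and one \<open>r\<close> for fixed \<open>m\<close>.\<close>

lemma cycle_max_fall:
  assumes "partial_perm n (Suc h) \<tau>" "m \<in> missing n \<tau>"
  shows "cycle_max (Suc n) (fall n r m \<tau>) \<longleftrightarrow> exit_value n \<tau> m = Suc n + r"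
  using cycle_max_Suc_ins[OF assms(1) shift_above_fall assms(2)] exit_value_gt[OF assms]
  by (auto simp: fall_shift_def)

lemma not_cycle_max_level:
  assumes "partial_perm n h \<tau>" "m \<in> missing n \<tau>"
  shows "\<not> cycle_max (Suc n) (level n h m \<tau>)"
  using cycle_max_Suc_ins[OF assms(1) shift_above_up assms(2)] up_shift_neq(1) by simp

lemma not_cycle_max_rise: "\<not> cycle_max (Suc n) (rise n r \<tau>)"
proof
  assume "cycle_max (Suc n) (rise n r \<tau>)"
  then have "(rise n r \<tau> ^^ 1) (Suc n) \<le> Suc n"
    unfolding cycle_max_def by blast
  then show False by simp
qed

lemma not_ear_at_level: "\<not> ear_at (Suc n) (level n h m \<tau>)"
  using Suc_notin_level[of n h m \<tau>] by (simp add: ear_at_def atLeastLessThanSuc_atLeastAtMost)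

lemma not_ear_at_rise: "\<not> ear_at (Suc n) (rise n r \<tau>)"
  by (simp add: ear_at_def)

lemma not_pex_at_ins: "m \<in> missing n \<tau> \<Longrightarrow> \<not> pex_at (Suc n) (ins n \<phi> m \<tau>)"
  by (simp add: pex_at_def missing_def)

lemma strict_mono_up_shift: "strict_mono (up_shift n r)"
  by (simp add: strict_mono_def up_shift_less_iff)

lemma strict_mono_fall_shift_0: "strict_mono (fall_shift n 0)"
  by (auto simp: strict_mono_def fall_shift_def)

section \<open>Weights of insertions and the passage to Motzkin paths\<close>

definition weight :: "(nat \<Rightarrow> (nat \<Rightarrow> nat) \<Rightarrow> bool) \<Rightarrow> (nat \<Rightarrow> (nat \<Rightarrow> nat) \<Rightarrow> bool) \<Rightarrow> 'a \<Rightarrow> 'a \<Rightarrow>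
    nat \<Rightarrow> (nat \<Rightarrow> nat) \<Rightarrow> 'a::comm_ring_1" where
  "weight P Q u v n \<tau> = u ^ stat P n \<tau> * v ^ stat Q n \<tau>"

lemma weight_Suc:
  assumes "\<And>p. p \<in> {1..n} \<Longrightarrow> P p \<tau>' = P p \<tau>" "\<And>p. p \<in> {1..n} \<Longrightarrow> Q p \<tau>' = Q p \<tau>"
  shows "weight P Q u v (Suc n) \<tau>' =
    weight P Q u v n \<tau> * ((if P (Suc n) \<tau>' then u else 1) * (if Q (Suc n) \<tau>' then v else 1))"
proof -
  have "stat P (Suc n) \<tau>' = stat P n \<tau> + (if P (Suc n) \<tau>' then 1 else 0)"
       "stat Q (Suc n) \<tau>' = stat Q n \<tau> + (if Q (Suc n) \<tau>' then 1 else 0)"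
    by (rule stat_ins, erule assms)+
  then show ?thesis
    by (simp add: weight_def algebra_simps)
qed

lemma exc_eq_stat: "exc n \<tau> = stat (\<lambda>p \<tau>. p < \<tau> p) n \<tau>"
  by (simp add: exc_def stat_def)

lemma exc_ins:
  assumes "shift_above n \<phi>"
  shows "exc (Suc n) (ins n \<phi> x \<tau>) = exc n \<tau> + (if Suc n < x then 1 else 0)"
  unfolding exc_eq_stat by (subst stat_ins) (auto simp: exc_at_ins[OF assms])

text \<open>The induction shared by both schemes: \<open>R h\<close> contains the ranks available to
  a rise from height \<open>h\<close>, and \<open>T h\<close> those available to a fall to height
  \<open>h\<close>. Only a rise adds an excedance, so \<open>exc\<close> counts the rises.\<close>

lemma sum_partial_perms_eq_motzkin:
  fixes w :: "nat \<Rightarrow> (nat \<Rightarrow> nat) \<Rightarrow> 'a::comm_ring_1"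
  assumes S: "\<And>n h. S n h \<subseteq> Collect (partial_perm n h)" "S 0 0 = {id}"
    and rec: "\<And>n h (g :: (nat \<Rightarrow> nat) \<Rightarrow> 'a). sum g (S (Suc n) h) =
      (if h = 0 then 0 else \<Sum>\<tau>\<in>S n (h - 1). \<Sum>r\<in>R (h - 1). g (rise n r \<tau>)) +
      (\<Sum>\<tau>\<in>S n h. \<Sum>m\<in>missing n \<tau>. g (level n h m \<tau>)) +
      (\<Sum>\<tau>\<in>S n (Suc h). \<Sum>(r, m)\<in>T h \<times> missing n \<tau>. g (fall n r m \<tau>))"
    and w_0: "w 0 id = 1"
    and w_rise: "\<And>n h \<tau>. partial_perm n h \<tau> \<Longrightarrow> (\<Sum>r\<in>R h. w (Suc n) (rise n r \<tau>)) = a (Suc h) * w n \<tau>"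
    and w_level: "\<And>n h \<tau> m. partial_perm n h \<tau> \<Longrightarrow> m \<in> missing n \<tau> \<Longrightarrow> w (Suc n) (level n h m \<tau>) = w n \<tau>"
    and w_fall: "\<And>n h \<tau>. partial_perm n (Suc h) \<tau> \<Longrightarrow>
      (\<Sum>(r, m)\<in>T h \<times> missing n \<tau>. w (Suc n) (fall n r m \<tau>)) = b (Suc h) * w n \<tau>"
  shows "(\<Sum>\<tau>\<in>S n h. if exc n \<tau> = k then w n \<tau> else 0) = motzkin a b n h k"
proof (induction n arbitrary: h k)
  case 0
  show ?case
  proof (cases h)
    case 0
    then show ?thesis using S(2) w_0 by (simp add: exc_def)
  next
    case (Suc h')
    then have "S 0 h = {}"
      using S(1)[of 0 h] by (simp add: partial_perm_0)
    then show ?thesis using Suc by simp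
  qed
next
  case (Suc n)
  have st: "partial_perm n h \<tau>" if "\<tau> \<in> S n h" for h \<tau>
    using that S(1)[of n h] by blast
  let ?g = "\<lambda>k n \<tau>. if exc n \<tau> = k then w n \<tau> else 0"
  have 1: "(\<Sum>\<tau>\<in>S n h'. \<Sum>r\<in>R h'. ?g k (Suc n) (rise n r \<tau>)) =
      (if k = 0 then 0 else a (Suc h') * motzkin a b n h' (k - 1))" for h'
  proof -
    have "(\<Sum>r\<in>R h'. ?g k (Suc n) (rise n r \<tau>)) =
        (if k = 0 then 0 else a (Suc h') * ?g (k - 1) n \<tau>)" if "\<tau> \<in> S n h'" for \<tau>
    proof -
      have "(\<Sum>r\<in>R h'. ?g k (Suc n) (rise n r \<tau>)) =
          (\<Sum>r\<in>R h'. if Suc (exc n \<tau>) = k then w (Suc n) (rise n r \<tau>) else 0)"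
        by (simp add: exc_ins)
      also have "\<dots> = (if Suc (exc n \<tau>) = k then a (Suc h') * w n \<tau> else 0)"
        using w_rise[OF st[OF that]] by simp
      finally show ?thesis by auto
    qed
    then have "(\<Sum>\<tau>\<in>S n h'. \<Sum>r\<in>R h'. ?g k (Suc n) (rise n r \<tau>)) =
        (\<Sum>\<tau>\<in>S n h'. if k = 0 then 0 else a (Suc h') * ?g (k - 1) n \<tau>)"
      by (rule sum.cong[OF refl])
    also have "\<dots> = (if k = 0 then 0 else a (Suc h') * (\<Sum>\<tau>\<in>S n h'. ?g (k - 1) n \<tau>))"
      by (simp only: sum_distrib_left sum.neutral_const split: if_split) simp
    finally show ?thesis
      by (simp only: Suc.IH)
  qed
  have 2: "(\<Sum>\<tau>\<in>S n h. \<Sum>m\<in>missing n \<tau>. ?g k (Suc n) (level n h m \<tau>)) = of_nat h * motzkin a b n h k"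
  proof -
    have "(\<Sum>m\<in>missing n \<tau>. ?g k (Suc n) (level n h m \<tau>)) = of_nat h * ?g k n \<tau>" if "\<tau> \<in> S n h" for \<tau>
    proof -
      have "(\<Sum>m\<in>missing n \<tau>. ?g k (Suc n) (level n h m \<tau>)) = (\<Sum>m\<in>missing n \<tau>. ?g k n \<tau>)"
      proof (rule sum.cong[OF refl])
        fix m assume m: "m \<in> missing n \<tau>"
        then have "\<not> Suc n < m" by (simp add: missing_def)
        then show "?g k (Suc n) (level n h m \<tau>) = ?g k n \<tau>"
          using w_level[OF st[OF that] m] by (simp add: exc_ins)
      qed
      then show ?thesis
        using card_missing[OF st[OF that]] by simp
    qed
    then have "(\<Sum>\<tau>\<in>S n h. \<Sum>m\<in>missing n \<tau>. ?g k (Suc n) (level n h m \<tau>)) =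
        (\<Sum>\<tau>\<in>S n h. of_nat h * ?g k n \<tau>)"
      by (rule sum.cong[OF refl])
    also have "\<dots> = of_nat h * (\<Sum>\<tau>\<in>S n h. ?g k n \<tau>)"
      by (simp only: sum_distrib_left)
    finally show ?thesis
      by (simp only: Suc.IH)
  qed
  have 3: "(\<Sum>\<tau>\<in>S n (Suc h). \<Sum>(r, m)\<in>T h \<times> missing n \<tau>. ?g k (Suc n) (fall n r m \<tau>)) =
      b (Suc h) * motzkin a b n (Suc h) k"
  proof -
    have "(\<Sum>(r, m)\<in>T h \<times> missing n \<tau>. ?g k (Suc n) (fall n r m \<tau>)) = b (Suc h) * ?g k n \<tau>"
      if "\<tau> \<in> S n (Suc h)" for \<tau>
    proof -
      have "(\<Sum>(r, m)\<in>T h \<times> missing n \<tau>. ?g k (Suc n) (fall n r m \<tau>)) =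
          (\<Sum>(r, m)\<in>T h \<times> missing n \<tau>. if exc n \<tau> = k then w (Suc n) (fall n r m \<tau>) else 0)"
      proof (rule sum.cong[OF refl], clarify)
        fix r m assume m: "m \<in> missing n \<tau>"
        then have "\<not> Suc n < m" by (simp add: missing_def)
        then show "?g k (Suc n) (fall n r m \<tau>) = (if exc n \<tau> = k then w (Suc n) (fall n r m \<tau>) else 0)"
          by (simp add: exc_ins)
      qed
      also have "\<dots> = b (Suc h) * ?g k n \<tau>"
        using w_fall[OF st[OF that]] by (simp add: case_prod_unfold)
      finally show ?thesis .
    qed
    then have "(\<Sum>\<tau>\<in>S n (Suc h). \<Sum>(r, m)\<in>T h \<times> missing n \<tau>. ?g k (Suc n) (fall n r m \<tau>)) =
        (\<Sum>\<tau>\<in>S n (Suc h). b (Suc h) * ?g k n \<tau>)"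
      by (rule sum.cong[OF refl])
    also have "\<dots> = b (Suc h) * (\<Sum>\<tau>\<in>S n (Suc h). ?g k n \<tau>)"
      by (simp only: sum_distrib_left)
    finally show ?thesis
      by (simp only: Suc.IH)
  qed
  show ?case
  proof (cases h)
    case 0
    then show ?thesis unfolding rec 2 3 by simp
  next
    case (Suc h')
    show ?thesis unfolding rec 2 3 unfolding Suc diff_Suc_1 1 by simp
  qed
qed

lemma weight_0: "weight P Q u v 0 \<tau> = 1"
  by (simp add: weight_def stat_def)

lemma sum_missing_min:
  fixes y :: "'a::comm_ring_1"
  assumes "partial_perm n (Suc h) \<tau>"
  shows "(\<Sum>m\<in>missing n \<tau>. if m = Min (missing n \<tau>) then y else 1) = y + of_nat (Suc h) - 1"
proof -
  have "missing n \<tau> \<noteq> {}"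
    using card_missing[OF assms] by auto
  then show ?thesis
    using sum_if_unique[of "missing n \<tau>" "Min (missing n \<tau>)" "\<lambda>m. m = Min (missing n \<tau>)" y]
      card_missing[OF assms] by simp
qed

lemma sum_missing_exit:
  fixes y :: "'a::comm_ring_1"
  assumes "partial_perm n (Suc h) \<tau>"
  shows "(\<Sum>m\<in>missing n \<tau>. if exit_value n \<tau> m = Suc n then y else 1) = y + of_nat (Suc h) - 1"
proof -
  have bij: "bij_betw (exit_value n \<tau>) (missing n \<tau>) {Suc n..n + Suc h}"
    by (rule exit_value_bij[OF assms])
  have "Suc n \<in> {Suc n..n + Suc h}" by simp
  then obtain m where m: "m \<in> missing n \<tau>" "exit_value n \<tau> m = Suc n"
    using bij_betw_imp_surj_on[OF bij] by (metis imageE)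
  have "(\<Sum>m\<in>missing n \<tau>. if exit_value n \<tau> m = Suc n then y else 1) =
      y + of_nat (card (missing n \<tau>)) - 1"
  proof (rule sum_if_unique)
    fix z assume "z \<in> missing n \<tau>"
    then show "exit_value n \<tau> z = Suc n \<longleftrightarrow> z = m"
      using inj_on_eq_iff[OF bij_betw_imp_inj_on[OF bij], of z m] m by simp
  qed (simp_all add: m)
  then show ?thesis
    by (simp only: card_missing[OF assms])
qed

lemma sum_exit_rank:
  fixes y :: "'a::comm_ring_1"
  assumes "partial_perm n (Suc h) \<tau>" "m \<in> missing n \<tau>"
  shows "(\<Sum>r\<le>h. if exit_value n \<tau> m = Suc n + r then y else 1) = y + of_nat (Suc h) - 1"
proof -
  have "exit_value n \<tau> m \<in> {Suc n..n + Suc h}"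
    using bij_betw_imp_surj_on[OF exit_value_bij[OF assms(1)]] assms(2) by blast
  then have "(\<Sum>r\<le>h. if exit_value n \<tau> m = Suc n + r then y else 1) = y + of_nat (card {..h}) - 1"
    by (intro sum_if_unique[of _ "exit_value n \<tau> m - Suc n"]) auto
  then show ?thesis
    by simp
qed

lemma weight_pex_ear_ins:
  assumes "shift_above n \<phi>" "strict_mono \<phi>"
  shows "weight pex_at ear_at u v (Suc n) (ins n \<phi> x \<tau>) = weight pex_at ear_at u v n \<tau> *
    ((if pex_at (Suc n) (ins n \<phi> x \<tau>) then u else 1) * (if ear_at (Suc n) (ins n \<phi> x \<tau>) then v else 1))"
  by (rule weight_Suc) (simp_all add: pex_at_ins ear_at_ins assms)

lemma weight_cycle_max_pex_ins:
  assumes "partial_perm n h \<tau>" "shift_above n \<phi>" "strict_mono \<phi>"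
  shows "weight cycle_max pex_at u v (Suc n) (ins n \<phi> x \<tau>) = weight cycle_max pex_at u v n \<tau> *
    ((if cycle_max (Suc n) (ins n \<phi> x \<tau>) then u else 1) * (if pex_at (Suc n) (ins n \<phi> x \<tau>) then v else 1))"
  by (rule weight_Suc) (simp_all add: pex_at_ins cycle_max_ins[OF assms(1)] assms)

lemma weight_cycle_max_ear_ins:
  assumes "partial_perm n h \<tau>" "shift_above n \<phi>"
  shows "weight cycle_max ear_at u v (Suc n) (ins n \<phi> x \<tau>) = weight cycle_max ear_at u v n \<tau> *
    ((if cycle_max (Suc n) (ins n \<phi> x \<tau>) then u else 1) * (if ear_at (Suc n) (ins n \<phi> x \<tau>) then v else 1))"
  by (rule weight_Suc) (simp_all add: ear_at_ins cycle_max_ins[OF assms(1)] assms)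

lemma sum_partial_perms_pex_ear:
  "(\<Sum>\<tau>\<in>Collect (partial_perm n h). if exc n \<tau> = k then weight pex_at ear_at lam y n \<tau> else 0) =
    motzkin (\<lambda>i. lam + of_nat i - 1) (\<lambda>i. y + of_nat i - 1) n h k"
proof (rule sum_partial_perms_eq_motzkin[of "\<lambda>n h. Collect (partial_perm n h)" "\<lambda>h. {..h}" "\<lambda>h. {0}"])
  fix n h \<tau>
  show "sum g (Collect (partial_perm (Suc n) h)) =
      (if h = 0 then 0 else \<Sum>\<tau>\<in>Collect (partial_perm n (h - 1)). \<Sum>r\<in>{..h - 1}. g (rise n r \<tau>)) +
      (\<Sum>\<tau>\<in>Collect (partial_perm n h). \<Sum>m\<in>missing n \<tau>. g (level n h m \<tau>)) +
      (\<Sum>\<tau>\<in>Collect (partial_perm n (Suc h)). \<Sum>(r, m)\<in>{0} \<times> missing n \<tau>. g (fall n r m \<tau>))" for g :: "_ \<Rightarrow> 'a"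
    unfolding sum_partial_perms_Suc by (simp add: sum.cartesian_product[symmetric])
  show "(\<Sum>r\<in>{..h}. weight pex_at ear_at lam y (Suc n) (rise n r \<tau>)) =
      (lam + of_nat (Suc h) - 1) * weight pex_at ear_at lam y n \<tau>" if "partial_perm n h \<tau>"
  proof -
    have "(\<Sum>r\<in>{..h}. weight pex_at ear_at lam y (Suc n) (rise n r \<tau>)) =
        (\<Sum>r\<in>{..h}. weight pex_at ear_at lam y n \<tau> * (if r = 0 then lam else 1))"
      using pex_at_rise[OF that]
      by (intro sum.cong refl) (simp add: weight_pex_ear_ins[OF shift_above_up strict_mono_up_shift] not_ear_at_rise)
    also have "\<dots> = weight pex_at ear_at lam y n \<tau> * (lam + of_nat (card {..h}) - 1)"
      unfolding sum_distrib_left[symmetric] by (subst sum_if_unique[of _ 0]) auto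
    finally show ?thesis by (simp add: mult.commute)
  qed
  show "weight pex_at ear_at lam y (Suc n) (level n h m \<tau>) = weight pex_at ear_at lam y n \<tau>"
    if "partial_perm n h \<tau>" "m \<in> missing n \<tau>" for m
    using that by (simp add: weight_pex_ear_ins[OF shift_above_up strict_mono_up_shift] not_ear_at_level not_pex_at_ins)
  show "(\<Sum>(r, m)\<in>{0} \<times> missing n \<tau>. weight pex_at ear_at lam y (Suc n) (fall n r m \<tau>)) =
      (y + of_nat (Suc h) - 1) * weight pex_at ear_at lam y n \<tau>" if "partial_perm n (Suc h) \<tau>"
  proof -
    have "(\<Sum>m\<in>missing n \<tau>. weight pex_at ear_at lam y (Suc n) (fall n 0 m \<tau>)) =
        (\<Sum>m\<in>missing n \<tau>. weight pex_at ear_at lam y n \<tau> * (if m = Min (missing n \<tau>) then y else 1))"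
      using ear_at_fall[OF that]
      by (intro sum.cong refl) (simp add: weight_pex_ear_ins[OF shift_above_fall strict_mono_fall_shift_0] not_pex_at_ins)
    also have "\<dots> = weight pex_at ear_at lam y n \<tau> * (y + of_nat (Suc h) - 1)"
      unfolding sum_distrib_left[symmetric] sum_missing_min[OF that] ..
    finally show ?thesis
      by (simp add: sum.cartesian_product[symmetric] mult.commute)
  qed
qed (simp_all add: partial_perm_0 weight_0)

lemma sum_partial_perms_cycle_max_pex:
  "(\<Sum>\<tau>\<in>Collect (partial_perm n h). if exc n \<tau> = k then weight cycle_max pex_at lam y n \<tau> else 0) =
    motzkin (\<lambda>i. y + of_nat i - 1) (\<lambda>i. lam + of_nat i - 1) n h k"
proof (rule sum_partial_perms_eq_motzkin[of "\<lambda>n h. Collect (partial_perm n h)" "\<lambda>h. {..h}" "\<lambda>h. {0}"])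
  fix n h \<tau>
  show "sum g (Collect (partial_perm (Suc n) h)) =
      (if h = 0 then 0 else \<Sum>\<tau>\<in>Collect (partial_perm n (h - 1)). \<Sum>r\<in>{..h - 1}. g (rise n r \<tau>)) +
      (\<Sum>\<tau>\<in>Collect (partial_perm n h). \<Sum>m\<in>missing n \<tau>. g (level n h m \<tau>)) +
      (\<Sum>\<tau>\<in>Collect (partial_perm n (Suc h)). \<Sum>(r, m)\<in>{0} \<times> missing n \<tau>. g (fall n r m \<tau>))" for g :: "_ \<Rightarrow> 'a"
    unfolding sum_partial_perms_Suc by (simp add: sum.cartesian_product[symmetric])
  show "(\<Sum>r\<in>{..h}. weight cycle_max pex_at lam y (Suc n) (rise n r \<tau>)) =
      (y + of_nat (Suc h) - 1) * weight cycle_max pex_at lam y n \<tau>" if "partial_perm n h \<tau>"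
  proof -
    have "(\<Sum>r\<in>{..h}. weight cycle_max pex_at lam y (Suc n) (rise n r \<tau>)) =
        (\<Sum>r\<in>{..h}. weight cycle_max pex_at lam y n \<tau> * (if r = 0 then y else 1))"
      using pex_at_rise[OF that]
      by (intro sum.cong refl)
        (simp add: weight_cycle_max_pex_ins[OF that shift_above_up strict_mono_up_shift] not_cycle_max_rise)
    also have "\<dots> = weight cycle_max pex_at lam y n \<tau> * (y + of_nat (card {..h}) - 1)"
      unfolding sum_distrib_left[symmetric] by (subst sum_if_unique[of _ 0]) auto
    finally show ?thesis by (simp add: mult.commute)
  qed
  show "weight cycle_max pex_at lam y (Suc n) (level n h m \<tau>) = weight cycle_max pex_at lam y n \<tau>"
    if "partial_perm n h \<tau>" "m \<in> missing n \<tau>" for m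
    using that by (simp add: weight_cycle_max_pex_ins[OF that(1) shift_above_up strict_mono_up_shift]
        not_cycle_max_level not_pex_at_ins)
  show "(\<Sum>(r, m)\<in>{0} \<times> missing n \<tau>. weight cycle_max pex_at lam y (Suc n) (fall n r m \<tau>)) =
      (lam + of_nat (Suc h) - 1) * weight cycle_max pex_at lam y n \<tau>" if "partial_perm n (Suc h) \<tau>"
  proof -
    have "(\<Sum>m\<in>missing n \<tau>. weight cycle_max pex_at lam y (Suc n) (fall n 0 m \<tau>)) =
        (\<Sum>m\<in>missing n \<tau>. weight cycle_max pex_at lam y n \<tau> *
          (if exit_value n \<tau> m = Suc n then lam else 1))"
      using cycle_max_fall[OF that]
      by (intro sum.cong refl)
        (simp add: weight_cycle_max_pex_ins[OF that shift_above_fall strict_mono_fall_shift_0] not_pex_at_ins)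
    also have "\<dots> = weight cycle_max pex_at lam y n \<tau> * (lam + of_nat (Suc h) - 1)"
      unfolding sum_distrib_left[symmetric] sum_missing_exit[OF that] ..
    finally show ?thesis
      by (simp add: sum.cartesian_product[symmetric] mult.commute)
  qed
qed (simp_all add: partial_perm_0 weight_0)

lemma sum_partial_perms_cycle_max_ear:
  "(\<Sum>\<tau> | partial_perm n h \<tau> \<and> incr n \<tau>. if exc n \<tau> = k then weight cycle_max ear_at lam y n \<tau> else 0) =
    motzkin (\<lambda>_. 1) (\<lambda>i. (lam + of_nat i - 1) * (y + of_nat i - 1)) n h k"
proof (rule sum_partial_perms_eq_motzkin[of "\<lambda>n h. {\<tau>. partial_perm n h \<tau> \<and> incr n \<tau>}" "\<lambda>h. {h}" "\<lambda>h. {..h}"])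
  fix n h \<tau>
  show "sum g {\<tau>. partial_perm (Suc n) h \<tau> \<and> incr (Suc n) \<tau>} =
      (if h = 0 then 0 else \<Sum>\<tau> | partial_perm n (h - 1) \<tau> \<and> incr n \<tau>. \<Sum>r\<in>{h - 1}. g (rise n r \<tau>)) +
      (\<Sum>\<tau> | partial_perm n h \<tau> \<and> incr n \<tau>. \<Sum>m\<in>missing n \<tau>. g (level n h m \<tau>)) +
      (\<Sum>\<tau> | partial_perm n (Suc h) \<tau> \<and> incr n \<tau>. \<Sum>(r, m)\<in>{..h} \<times> missing n \<tau>. g (fall n r m \<tau>))" for g :: "_ \<Rightarrow> 'a"
    unfolding sum_incr_partial_perms_Suc by simp
  show "(\<Sum>r\<in>{h}. weight cycle_max ear_at lam y (Suc n) (rise n r \<tau>)) =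
      1 * weight cycle_max ear_at lam y n \<tau>" if "partial_perm n h \<tau>"
    by (simp add: weight_cycle_max_ear_ins[OF that shift_above_up] not_cycle_max_rise not_ear_at_rise)
  show "weight cycle_max ear_at lam y (Suc n) (level n h m \<tau>) = weight cycle_max ear_at lam y n \<tau>"
    if "partial_perm n h \<tau>" "m \<in> missing n \<tau>" for m
    using that by (simp add: weight_cycle_max_ear_ins[OF that(1) shift_above_up] not_cycle_max_level not_ear_at_level)
  show "(\<Sum>(r, m)\<in>{..h} \<times> missing n \<tau>. weight cycle_max ear_at lam y (Suc n) (fall n r m \<tau>)) =
      (lam + of_nat (Suc h) - 1) * (y + of_nat (Suc h) - 1) * weight cycle_max ear_at lam y n \<tau>"
    if "partial_perm n (Suc h) \<tau>"
  proof -
    \<comment> \<open>Summing over \<open>r\<close> first is essential: the cyc factor then has the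
      same value for every \<open>m\<close> and leaves the sum over \<open>m\<close>, in which only
      ear remains.\<close>
    have "(\<Sum>(r, m)\<in>{..h} \<times> missing n \<tau>. weight cycle_max ear_at lam y (Suc n) (fall n r m \<tau>)) =
        (\<Sum>m\<in>missing n \<tau>. \<Sum>r\<le>h. weight cycle_max ear_at lam y (Suc n) (fall n r m \<tau>))"
      unfolding sum.cartesian_product[symmetric] by (rule sum.swap)
    also have "\<dots> = (\<Sum>m\<in>missing n \<tau>. \<Sum>r\<le>h. (if exit_value n \<tau> m = Suc n + r then lam else 1) *
        (weight cycle_max ear_at lam y n \<tau> * (if m = Min (missing n \<tau>) then y else 1)))"
      using cycle_max_fall[OF that] ear_at_fall[OF that]
      by (intro sum.cong refl) (simp add: weight_cycle_max_ear_ins[OF that shift_above_fall])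
    also have "\<dots> = (\<Sum>m\<in>missing n \<tau>. (lam + of_nat (Suc h) - 1) *
        (weight cycle_max ear_at lam y n \<tau> * (if m = Min (missing n \<tau>) then y else 1)))"
      by (intro sum.cong refl) (simp only: sum_distrib_right[symmetric] sum_exit_rank[OF that])
    also have "\<dots> = (lam + of_nat (Suc h) - 1) *
        (weight cycle_max ear_at lam y n \<tau> * (y + of_nat (Suc h) - 1))"
      unfolding sum_distrib_left[symmetric] sum_missing_min[OF that] ..
    finally show ?thesis
      by (simp only: mult.assoc mult.commute mult.left_commute)
  qed
qed (auto simp: partial_perm_0 weight_0 incr_def partial_perm_def)

section \<open>Derangements without cycle double rises\<close>

text \<open>At height 0 there are no placeholders, so \<open>\<tau>\<close> permutes
  \<open>{1..n}\<close>. That \<open>i\<close> is the image of a smaller point then means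
  \<open>inv \<tau> i < i\<close>, and the last conjunct of \<open>partial_perm\<close> excludes
  exactly fixed points and cycle double rises.\<close>

lemma derangements_star_eq: "derangements_star n k = {\<tau>. partial_perm n 0 \<tau> \<and> exc n \<tau> = k}"
proof -
  have "\<tau> \<in> derangements n \<and> cdrise n \<tau> = 0 \<longleftrightarrow> partial_perm n 0 \<tau>" for \<tau>
  proof
    assume *: "\<tau> \<in> derangements n \<and> cdrise n \<tau> = 0"
    then have p: "\<tau> permutes {1..n}" and nf: "\<And>i. i \<in> {1..n} \<Longrightarrow> \<tau> i \<noteq> i"
      by (auto simp: derangements_def)
    have cd: "\<not> (inv \<tau> i < i \<and> i < \<tau> i)" if "i \<in> {1..n}" for i
      using * that by (auto simp: cdrise_def)
    have "i \<notin> \<tau> ` {1..<i}" if "i \<in> {1..n}" "i < \<tau> i" for i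
    proof
      assume "i \<in> \<tau> ` {1..<i}"
      then obtain j where j: "j < i" "i = \<tau> j" by auto
      then have "inv \<tau> i = j"
        using permutes_inverses(2)[OF p] by simp
      then show False
        using cd[OF that(1)] j that(2) by simp
    qed
    moreover have "inj_on \<tau> {1..n}" "\<tau> ` {1..n} = {1..n}" "\<forall>i. i \<notin> {1..n} \<longrightarrow> \<tau> i = i"
      using p permutes_inj_on[OF p] permutes_image[OF p] permutes_not_in[OF p] by auto
    ultimately show "partial_perm n 0 \<tau>"
      unfolding partial_perm_def using nf by auto
  next
    assume st: "partial_perm n 0 \<tau>"
    then have "\<tau> ` {1..n} \<subseteq> {1..n}"
      unfolding partial_perm_def by (metis add_0_right)
    then have "\<tau> ` {1..n} = {1..n}"
      using partial_perm_inj[OF st] by (intro endo_inj_surj) auto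
    then have "bij_betw \<tau> {1..n} {1..n}"
      using partial_perm_inj[OF st] by (simp add: bij_betw_def)
    then have p: "\<tau> permutes {1..n}"
      using st unfolding partial_perm_def by (metis bij_imp_permutes)
    have "{i\<in>{1..n}. inv \<tau> i < i \<and> i < \<tau> i} = {}"
    proof -
      have False if i: "i \<in> {1..n}" "inv \<tau> i < i" "i < \<tau> i" for i
      proof -
        have "inv \<tau> i \<in> {1..n}"
          using permutes_in_image[OF permutes_inv[OF p]] i(1) by blast
        then have "i \<in> \<tau> ` {1..<i}"
          by (intro image_eqI[of _ _ "inv \<tau> i"]) (use i permutes_inverses(1)[OF p] in auto)
        then show False
          using st i unfolding partial_perm_def by blast
      qed
      then show ?thesis by blast
    qed
    then have "cdrise n \<tau> = 0"
      unfolding cdrise_def by (simp only: card.empty)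
    moreover have "\<tau> \<in> derangements n"
      unfolding derangements_def using p st unfolding partial_perm_def by blast
    ultimately show "\<tau> \<in> derangements n \<and> cdrise n \<tau> = 0" by blast
  qed
  then show ?thesis
    unfolding derangements_star_def by blast
qed

lemma derangements_star_permutes: "\<tau> \<in> derangements_star n k \<Longrightarrow> \<tau> permutes {1..n}"
  by (simp add: derangements_star_def derangements_def)

lemma pex_eq_stat: "pex n \<tau> = stat pex_at n \<tau>"
  by (simp add: pex_def stat_def pex_at_def)

text \<open>Each orbit has exactly one point that bounds all its iterates, namely its
  maximum.\<close>

lemma cyc_eq_stat:
  assumes p: "\<tau> permutes {1..n}"
  shows "cyc n \<tau> = stat cycle_max n \<tau>"
proof -
  have perm: "permutation \<tau>"
    using p by (auto simp: permutation_permutes)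
  note alt = orbit_altdef_permutation[OF perm]
  have "bij_betw (orbit \<tau>) {p\<in>{1..n}. cycle_max p \<tau>} (orbit \<tau> ` {1..n})"
  proof (rule bij_betw_imageI)
    have le: "q \<le> p" if "orbit \<tau> p = orbit \<tau> q" "cycle_max p \<tau>" for p q
    proof -
      have "q \<in> orbit \<tau> p"
        using permutation_self_in_orbit[OF perm, of q] that(1) by simp
      then show ?thesis
        using that(2) unfolding alt cycle_max_def by blast
    qed
    show "inj_on (orbit \<tau>) {p\<in>{1..n}. cycle_max p \<tau>}"
      by (rule inj_onI) (use le in \<open>force intro: order_antisym\<close>)
    show "orbit \<tau> ` {p\<in>{1..n}. cycle_max p \<tau>} = orbit \<tau> ` {1..n}"
    proof (intro equalityI image_subsetI)
      fix x assume x: "x \<in> {1..n}"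
      define q where "q = Max (orbit \<tau> x)"
      have sub: "orbit \<tau> x \<subseteq> {1..n}"
        by (rule permutes_orbit_subset[OF p x])
      then have fin: "finite (orbit \<tau> x)"
        by (rule finite_subset) simp
      then have q: "q \<in> orbit \<tau> x"
        unfolding q_def by (rule Max_in) (rule orbit_nonempty)
      then have eq: "orbit \<tau> q = orbit \<tau> x"
        by (rule orbit_cyclic_eq3[OF cyclic_on_orbit'[OF perm]])
      have "(\<tau> ^^ k) q \<in> orbit \<tau> q" for k
        unfolding alt by blast
      then have "(\<tau> ^^ k) q \<in> orbit \<tau> x" for k
        by (simp only: eq)
      then have "cycle_max q \<tau>"
        unfolding cycle_max_def q_def using fin by simp
      then show "orbit \<tau> x \<in> orbit \<tau> ` {p\<in>{1..n}. cycle_max p \<tau>}"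
        using q sub eq by blast
    qed auto
  qed
  then show ?thesis
    using bij_betw_same_card by (fastforce simp: cyc_def stat_def)
qed

text \<open>By surjectivity, an antirecord is an index such that all values below its own are taken
  earlier. Exclusiveness comes for free, since a point with \<open>\<tau> i < i\<close> is never a
  record.\<close>

lemma ear_eq_stat:
  assumes p: "\<tau> permutes {1..n}"
  shows "ear n \<tau> = stat ear_at n \<tau>"
proof -
  have "is_exclusive_antirecord n \<tau> i \<and> is_cycle_peak n \<tau> i \<longleftrightarrow> ear_at i \<tau>" if i: "i \<in> {1..n}" for i
  proof -
    have inj: "inj_on \<tau> A" for A
      by (rule permutes_inj_on[OF p])
    have peak: "inv \<tau> i < i \<longleftrightarrow> i \<in> \<tau> ` {1..<i}"
    proof
      assume "inv \<tau> i < i"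
      moreover have "inv \<tau> i \<in> {1..n}"
        using permutes_in_image[OF permutes_inv[OF p]] i by blast
      ultimately show "i \<in> \<tau> ` {1..<i}"
        by (intro image_eqI[of _ _ "inv \<tau> i"]) (use permutes_inverses(1)[OF p] in auto)
    next
      assume "i \<in> \<tau> ` {1..<i}"
      then show "inv \<tau> i < i"
        using permutes_inverses(2)[OF p] by auto
    qed
    have rec: "\<not> is_record n \<tau> i" if "\<tau> i < i"
    proof
      assume *: "is_record n \<tau> i"
      have "\<tau> j \<in> {1..n}" if "j \<in> {1..<i}" for j
        using that i permutes_in_image[OF p, of j] by auto
      then have "\<tau> ` {1..<i} \<subseteq> {1..<\<tau> i}"
        using * unfolding is_record_def by fastforce
      \<comment> \<open>Pigeonhole: the \<open>i - 1\<close> earlier values would have to fit into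
        the \<open>\<tau> i - 1\<close> numbers below \<open>\<tau> i\<close>.\<close>
      then have "card (\<tau> ` {1..<i}) \<le> card {1..<\<tau> i}"
        by (intro card_mono) auto
      moreover have "\<tau> i \<in> {1..n}"
        using i permutes_in_image[OF p] by blast
      ultimately show False
        using that card_image[OF inj, of "{1..<i}"] by simp linarith
    qed
    have anti: "is_antirecord n \<tau> i \<longleftrightarrow> {1..<\<tau> i} \<subseteq> \<tau> ` {1..<i}"
    proof
      assume *: "is_antirecord n \<tau> i"
      show "{1..<\<tau> i} \<subseteq> \<tau> ` {1..<i}"
      proof
        fix v assume v: "v \<in> {1..<\<tau> i}"
        moreover have "\<tau> i \<in> {1..n}"
          using i permutes_in_image[OF p] by blast
        ultimately have "v \<in> \<tau> ` {1..n}"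
          using permutes_image[OF p] by simp
        then obtain j where j: "j \<in> {1..n}" "v = \<tau> j" by blast
        moreover have "j < i"
        proof (rule ccontr)
          assume "\<not> j < i"
          then consider "i = j" | "i < j" by linarith
          then show False
          proof cases
            case 1
            then show False using v j(2) by simp
          next
            case 2
            then have "\<tau> i < \<tau> j"
              using * j(1) by (simp add: is_antirecord_def)
            then show False using v j(2) by simp
          qed
        qed
        ultimately show "v \<in> \<tau> ` {1..<i}" by simp
      qed
    next
      assume *: "{1..<\<tau> i} \<subseteq> \<tau> ` {1..<i}"
      have "\<tau> i < \<tau> j" if j: "j \<in> {i<..n}" for j
      proof (rule ccontr)
        assume "\<not> \<tau> i < \<tau> j"
        moreover have "\<tau> j \<noteq> \<tau> i"
          using j permutes_inj[OF p] by (auto dest: injD)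
        moreover have "\<tau> j \<in> {1..n}"
          using j i permutes_in_image[OF p, of j] by auto
        ultimately have "\<tau> j \<in> \<tau> ` {1..<i}"
          using * by auto
        then obtain l where "l < i" "\<tau> j = \<tau> l" by auto
        then have "j = l"
          using permutes_inj[OF p] by (auto dest: injD)
        then show False
          using \<open>l < i\<close> j by simp
      qed
      then show "is_antirecord n \<tau> i"
        using i by (simp add: is_antirecord_def)
    qed
    show ?thesis
      using i rec by (auto simp: is_exclusive_antirecord_def is_cycle_peak_def ear_at_def peak anti)
  qed
  then show ?thesis
    unfolding ear_def stat_def by (intro arg_cong[of _ _ card]) auto
qed

lemma sum_derangements_star:
  "(\<Sum>\<tau>\<in>derangements_star n k. w \<tau>) =
    (\<Sum>\<tau>\<in>Collect (partial_perm n 0). if exc n \<tau> = k then w \<tau> else 0 :: 'a::comm_ring_1)"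
proof -
  have eq: "derangements_star n k = {\<tau>\<in>Collect (partial_perm n 0). exc n \<tau> = k}"
    by (auto simp: derangements_star_eq)
  show ?thesis
    unfolding eq by (rule sum.inter_filter) (rule finite_partial_perms)
qed

text \<open>Without open points the condition is void, so at height 0 both schemes sum over the same
  permutations.\<close>

lemma incr_closed: "{\<tau>. partial_perm n 0 \<tau> \<and> incr n \<tau>} = Collect (partial_perm n 0)"
proof -
  have "incr n \<tau>" if "partial_perm n 0 \<tau>" for \<tau>
  proof -
    have "\<not> n < \<tau> i" if "1 \<le> i" "i \<le> n" for i
      using partial_perm_bound[OF \<open>partial_perm n 0 \<tau>\<close>, of i] that by simp
    then show ?thesis
      by (simp add: incr_def)
  qed
  then show ?thesis by auto
qed

theorem theorem1p8:
  shows "\<exists>\<gamma> :: nat \<Rightarrow> nat \<Rightarrow> 'a::comm_ring_1 \<Rightarrow> 'a \<Rightarrow> 'a. \<forall>n.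
    (\<forall>t lam y. D_poly n t lam y =
        (\<Sum>k=0..n div 2. \<gamma> n k lam y * t ^ k * (1 + t) ^ (n - 2 * k))) \<and>
    (\<forall>k\<le>n div 2. \<forall>lam y.
        \<gamma> n k lam y = (\<Sum>\<sigma>\<in>derangements_star n k. lam ^ pex n \<sigma> * y ^ ear n \<sigma>) \<and>
        \<gamma> n k lam y = (\<Sum>\<sigma>\<in>derangements_star n k. lam ^ cyc n \<sigma> * y ^ ear n \<sigma>) \<and>
        \<gamma> n k lam y = (\<Sum>\<sigma>\<in>derangements_star n k. lam ^ cyc n \<sigma> * y ^ pex n \<sigma>))"
proof -
  define \<gamma> :: "nat \<Rightarrow> nat \<Rightarrow> 'a \<Rightarrow> 'a \<Rightarrow> 'a" where
    "\<gamma> n k lam y = motzkin (\<lambda>_. 1) (\<lambda>i. (lam + of_nat i - 1) * (y + of_nat i - 1)) n 0 k" for n k lam y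
  have 1: "\<gamma> n k lam y = (\<Sum>\<sigma>\<in>derangements_star n k. lam ^ pex n \<sigma> * y ^ ear n \<sigma>)" for n k lam y
  proof -
    have "(\<Sum>\<sigma>\<in>derangements_star n k. lam ^ pex n \<sigma> * y ^ ear n \<sigma>) =
        (\<Sum>\<sigma>\<in>derangements_star n k. weight pex_at ear_at lam y n \<sigma>)"
      by (intro sum.cong refl)
        (simp add: weight_def pex_eq_stat ear_eq_stat[OF derangements_star_permutes])
    \<comment> \<open>At height 0 the product in \<open>motzkin_rescale\<close> is empty, so the
      rise weights move to the falls without a correction.\<close>
    then show ?thesis
      unfolding sum_derangements_star sum_partial_perms_pex_ear \<gamma>_def
      by (subst (asm) motzkin_rescale) simp
  qed
  have 2: "\<gamma> n k lam y = (\<Sum>\<sigma>\<in>derangements_star n k. lam ^ cyc n \<sigma> * y ^ ear n \<sigma>)" for n k lam y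
  proof -
    have "(\<Sum>\<sigma>\<in>derangements_star n k. lam ^ cyc n \<sigma> * y ^ ear n \<sigma>) =
        (\<Sum>\<sigma>\<in>derangements_star n k. weight cycle_max ear_at lam y n \<sigma>)"
      by (intro sum.cong refl)
        (simp add: weight_def cyc_eq_stat[OF derangements_star_permutes] ear_eq_stat[OF derangements_star_permutes])
    then show ?thesis
      unfolding sum_derangements_star \<gamma>_def
      using sum_partial_perms_cycle_max_ear[of n k lam y 0] by (simp only: incr_closed)
  qed
  have 3: "\<gamma> n k lam y = (\<Sum>\<sigma>\<in>derangements_star n k. lam ^ cyc n \<sigma> * y ^ pex n \<sigma>)" for n k lam y
  proof -
    have "(\<Sum>\<sigma>\<in>derangements_star n k. lam ^ cyc n \<sigma> * y ^ pex n \<sigma>) =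
        (\<Sum>\<sigma>\<in>derangements_star n k. weight cycle_max pex_at lam y n \<sigma>)"
      by (intro sum.cong refl)
        (simp add: weight_def pex_eq_stat cyc_eq_stat[OF derangements_star_permutes])
    then show ?thesis
      unfolding sum_derangements_star sum_partial_perms_cycle_max_pex \<gamma>_def
      by (subst (asm) motzkin_rescale) (simp add: mult.commute)
  qed
  show ?thesis
  proof (intro exI[of _ \<gamma>] allI conjI impI)
    show "D_poly n t lam y = (\<Sum>k=0..n div 2. \<gamma> n k lam y * t ^ k * (1 + t) ^ (n - 2 * k))" for n t lam y
      unfolding \<gamma>_def by (rule D_poly_eq_sum_motzkin)
  qed (rule 1 2 3)+
qed

end
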